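(* Let $N\ge 2$ be an integer and $\alpha_N=2^{N-1}-1$. Let $\mathcal{S}_5^{(N)}=\{|\eta_k(+)\rangle,|\eta_k(-)\rangle : k=0,1,\dots,\alpha_N\}\subset\mathbb{C}^4\otimes(\mathbb{C}^2)^{\otimes(N-1)}$ be the set of mutually orthogonal $N$-partite states given up to normalization by $$|\eta_k(\pm)\rangle=|\mathbf{0},k\rangle\pm|\mathbf{1},\alpha_N-k\rangle\pm\bigl[\,|\mathbf{2},k\rangle\mp|\mathbf{3},\alpha_N-k\rangle\bigr],$$ where the first party holds $\mathbb{C}^4$ with standard basis $\{|\mathbf{0}\rangle,|\mathbf{1}\rangle,|\mathbf{2}\rangle,|\mathbf{3}\rangle\}$, each of the other $N-1$ parties holds one qubit, and $|k\rangle$ for $0\le k\le\alpha_N$ denotes the computational basis state of the $N-1$ qubits labelled by the $(N-1)$-bit binary expansion of $k$. Then $\mathcal{S}_5^{(N)}$ can be deterministically converted, via a local orthogonality preserving measurement (OPM), to a locally irreducible set of $N$-partite genuinely entangled states, which is moreover indistinguishable under LOCC even when all but one of the parties come together (that is, it is indistinguishable under LOCC across every bipartition of one party versus the remaining $N-1$ parties).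
   Context: All states are understood up to normalization. LOCC: protocols in which spatially separated parties perform local quantum operations on their own systems and exchange classical messages. LOCC across a bipartition means that the parties on each side of the bipartition are treated as a single party that may perform joint operations. Distinguishable under LOCC: a set of mutually orthogonal states is distinguishable under LOCC if, when the parties share one unknown state from the (known) set, some LOCC protocol identifies it with certainty; otherwise it is indistinguishable. Genuinely entangled: an $N$-partite pure state that is not a product state across any bipartition of the $N$ parties. Local OPM: a measurement $\{M_a\}$ (one operator $M_a$ per outcome, $\sum_a M_a^\dagger M_a=\mathbb{I}$) performed by one party on its own system such that, for each outcome, the (nonzero) post-measurement states of the set are mutually orthogonal. Locally irreducible: a set of mutually orthogonal multipartite states is locally irreducible if it is not possible to eliminate one or more states from the set (i.e. reach an outcome for which some, but not all, of the states are mapped to zero) by LOCC using orthogonality preserving local measurements. "Deterministically converted to a set with a property": there is a local OPM such that, for every outcome, the set of nonzero post-measurement states has that property. *)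

theory Defs
  imports Complex_Main "HOL-Library.FuncSet"
begin

text \<open>
  Finite-dimensional multipartite pure states in coordinates. The list \<open>ds\<close> of local dimensions
  fixes the number of parties \<open>length ds\<close>; party \<open>i\<close> holds the space with standard basis
  \<open>{..<ds ! i}\<close>. A standard basis vector of the joint space of the parties in \<open>A\<close> is an extensional
  function on \<open>A\<close>, and a vector of the total space is its coefficient function, which vanishes off
  the index set. Vectors are not required to be normalized.
\<close>

type_synonym config = "nat \<Rightarrow> nat"
type_synonym state = "config \<Rightarrow> complex"
type_synonym operator = "config \<Rightarrow> config \<Rightarrow> complex"

definition configs :: "nat list \<Rightarrow> nat set \<Rightarrow> config set" where
  "configs ds A = (\<Pi>\<^sub>E i\<in>A. {..<ds ! i})"

definition parties :: "nat list \<Rightarrow> nat set" where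
  "parties ds = {..<length ds}"

definition vectors :: "nat list \<Rightarrow> state set" where
  "vectors ds = {\<psi>. \<forall>x. x \<notin> configs ds (parties ds) \<longrightarrow> \<psi> x = 0}"

definition zero_vector :: state where
  "zero_vector = (\<lambda>_. 0)"

definition braket :: "nat list \<Rightarrow> state \<Rightarrow> state \<Rightarrow> complex" where
  "braket ds \<phi> \<psi> = (\<Sum>x\<in>configs ds (parties ds). cnj (\<phi> x) * \<psi> x)"

definition norm_sq :: "nat list \<Rightarrow> state \<Rightarrow> real" where
  "norm_sq ds \<psi> = (\<Sum>x\<in>configs ds (parties ds). (cmod (\<psi> x))\<^sup>2)"

definition mutually_orthogonal_states :: "nat list \<Rightarrow> state set \<Rightarrow> bool" where
  "mutually_orthogonal_states ds S \<longleftrightarrow>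
     S \<subseteq> vectors ds - {zero_vector} \<and> (\<forall>\<phi>\<in>S. \<forall>\<psi>\<in>S. \<phi> \<noteq> \<psi> \<longrightarrow> braket ds \<phi> \<psi> = 0)"

definition product_across :: "nat list \<Rightarrow> nat set \<Rightarrow> state \<Rightarrow> bool" where
  "product_across ds A \<psi> \<longleftrightarrow>
     (\<exists>f g. \<forall>x\<in>configs ds (parties ds).
        \<psi> x = f (restrict x A) * g (restrict x (parties ds - A)))"

definition genuinely_entangled :: "nat list \<Rightarrow> state \<Rightarrow> bool" where
  "genuinely_entangled ds \<psi> \<longleftrightarrow>
     (\<forall>A. A \<noteq> {} \<and> A \<subset> parties ds \<longrightarrow> \<not> product_across ds A \<psi>)"

text \<open>
  \<open>apply_local ds ds' A M\<close> is \<open>M\<close> on the parties in \<open>A\<close> tensored with the identity on the others.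
  The operator \<open>M\<close>, given by its matrix entries (row first), may change the local dimensions of the
  parties in \<open>A\<close> from \<open>ds\<close> to \<open>ds'\<close>; in particular ancillas and partial compression are covered.
\<close>

definition apply_local :: "nat list \<Rightarrow> nat list \<Rightarrow> nat set \<Rightarrow> operator \<Rightarrow> state \<Rightarrow> state" where
  "apply_local ds ds' A M \<psi> = (\<lambda>x.
     if x \<in> configs ds' (parties ds')
     then \<Sum>y\<in>configs ds A. M (restrict x A) y * \<psi> (override_on x y A)
     else 0)"

text \<open>
  A measurement performed jointly by the parties in \<open>A\<close> is a finite list of outcomes, each given by
  its output dimensions and its operator; the last conjunct is completeness, i.e. the sum of
  \<open>M\<^sup>\<dagger> M\<close> over all outcomes is the identity.
\<close>

definition measurement :: "nat list \<Rightarrow> nat set \<Rightarrow> (nat list \<times> operator) list \<Rightarrow> bool" where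
  "measurement ds A Ms \<longleftrightarrow>
     (\<forall>(ds', M)\<in>set Ms. length ds' = length ds \<and> (\<forall>i\<in>parties ds - A. ds' ! i = ds ! i)) \<and>
     (\<forall>y\<in>configs ds A. \<forall>y'\<in>configs ds A.
        (\<Sum>(ds', M)\<leftarrow>Ms. \<Sum>x\<in>configs ds' A. cnj (M x y) * M x y') = (if y = y' then 1 else 0))"

text \<open>
  Orthogonality is required for the images of any two different states of \<open>S\<close>. This does not
  degenerate when two states have the same nonzero image, which is then rejected.
\<close>

definition local_OPM ::
    "nat list \<Rightarrow> state set \<Rightarrow> nat \<Rightarrow> (nat list \<times> operator) list \<Rightarrow> bool" where
  "local_OPM ds S j Ms \<longleftrightarrow>
     j \<in> parties ds \<and> measurement ds {j} Ms \<and>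
     (\<forall>(ds', M)\<in>set Ms. \<forall>\<phi>\<in>S. \<forall>\<psi>\<in>S. \<phi> \<noteq> \<psi> \<longrightarrow>
        braket ds' (apply_local ds ds' {j} M \<phi>) (apply_local ds ds' {j} M \<psi>) = 0)"

definition deterministically_convertible ::
    "nat list \<Rightarrow> state set \<Rightarrow> (nat list \<Rightarrow> state set \<Rightarrow> bool) \<Rightarrow> bool" where
  "deterministically_convertible ds S Q \<longleftrightarrow>
     (\<exists>j Ms. local_OPM ds S j Ms \<and>
        (\<forall>(ds', M)\<in>set Ms. Q ds' (apply_local ds ds' {j} M ` S - {zero_vector})))"

text \<open>
  \<open>OPM_reachable ds S ds' K\<close>: some finite adaptive sequence of local orthogonality preserving
  measurements, started on \<open>S\<close>, has a sequence of outcomes whose accumulated operator is \<open>K\<close>. As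
  each step may depend on all earlier outcomes, a single branch determines reachability. Images equal
  to zero are kept in \<open>K ` S\<close>; they do not affect orthogonality.
\<close>

inductive OPM_reachable :: "nat list \<Rightarrow> state set \<Rightarrow> nat list \<Rightarrow> (state \<Rightarrow> state) \<Rightarrow> bool"
  for ds :: "nat list" and S :: "state set" where
  start: "OPM_reachable ds S ds id"
| step: "OPM_reachable ds S ds' K \<Longrightarrow> local_OPM ds' (K ` S) j Ms \<Longrightarrow> (ds'', M) \<in> set Ms \<Longrightarrow>
     OPM_reachable ds S ds'' (apply_local ds' ds'' {j} M \<circ> K)"

definition locally_irreducible :: "nat list \<Rightarrow> state set \<Rightarrow> bool" where
  "locally_irreducible ds S \<longleftrightarrow>
     mutually_orthogonal_states ds S \<and>
     \<not> (\<exists>ds' K. OPM_reachable ds S ds' K \<and>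
          (\<exists>\<psi>\<in>S. K \<psi> = zero_vector) \<and> (\<exists>\<psi>\<in>S. K \<psi> \<noteq> zero_vector))"

text \<open>
  LOCC protocols with finitely many rounds. In \<open>Measure A Ms cont\<close> the parties in \<open>A\<close> measure jointly
  and broadcast the outcome \<open>a\<close>, upon which the protocol continues with \<open>cont a\<close>. A local operation
  with several Kraus operators for one classical message is a measurement with equal continuations
  for these outcomes.
\<close>

datatype 'r protocol =
    Announce 'r
  | Measure "nat set" "(nat list \<times> operator) list" "nat \<Rightarrow> 'r protocol"

text \<open>
  \<open>P\<close> is the set of groups of parties that may act jointly, each confined to its own joint system.
\<close>

primrec LOCC :: "nat set set \<Rightarrow> 'r protocol \<Rightarrow> nat list \<Rightarrow> bool" where
  "LOCC P (Announce r) = (\<lambda>ds. True)"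
| "LOCC P (Measure A Ms cont) = (\<lambda>ds.
     A \<in> P \<and> A \<subseteq> parties ds \<and> measurement ds A Ms \<and>
     (\<forall>a<length Ms. LOCC P (cont a) (fst (Ms ! a))))"

text \<open>
  The weight of the answer \<open>r\<close> on input \<open>\<psi>\<close>; its probability is the weight divided by
  \<open>norm_sq ds \<psi>\<close>.
\<close>

primrec answer_weight :: "'r \<Rightarrow> 'r protocol \<Rightarrow> nat list \<Rightarrow> state \<Rightarrow> real" where
  "answer_weight r (Announce r') = (\<lambda>ds \<psi>. if r' = r then norm_sq ds \<psi> else 0)"
| "answer_weight r (Measure A Ms cont) = (\<lambda>ds \<psi>.
     \<Sum>a<length Ms. answer_weight r (cont a) (fst (Ms ! a))
       (apply_local ds (fst (Ms ! a)) A (snd (Ms ! a)) \<psi>))"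

definition answer_prob :: "'r \<Rightarrow> 'r protocol \<Rightarrow> nat list \<Rightarrow> state \<Rightarrow> real" where
  "answer_prob r p ds \<psi> = answer_weight r p ds \<psi> / norm_sq ds \<psi>"

definition LOCC_distinguishable :: "nat set set \<Rightarrow> nat list \<Rightarrow> state set \<Rightarrow> bool" where
  "LOCC_distinguishable P ds S \<longleftrightarrow>
     (\<exists>p :: state protocol. LOCC P p ds \<and> (\<forall>\<psi>\<in>S. answer_prob \<psi> p ds \<psi> = 1))"

definition LOCC_indistinguishable :: "nat set set \<Rightarrow> nat list \<Rightarrow> state set \<Rightarrow> bool" where
  "LOCC_indistinguishable P ds S \<longleftrightarrow>
     mutually_orthogonal_states ds S \<and> \<not> LOCC_distinguishable P ds S"

text \<open>
  Party \<open>0\<close> holds the four-dimensional system and party \<open>i\<close>, for \<open>0 < i < N\<close>, the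
  \<open>i\<close>-th most significant of the \<open>N - 1\<close> bits of \<open>k\<close>.
\<close>

definition \<alpha> :: "nat \<Rightarrow> nat" where
  "\<alpha> N = 2 ^ (N - 1) - 1"

definition dims :: "nat \<Rightarrow> nat list" where
  "dims N = 4 # replicate (N - 1) 2"

definition ket :: "nat \<Rightarrow> nat \<Rightarrow> nat \<Rightarrow> state" where
  "ket N a k = (\<lambda>x.
     if x = (\<lambda>i\<in>{..<N}. if i = 0 then a else k div 2 ^ (N - 1 - i) mod 2) then 1 else 0)"

text \<open>The argument \<open>s\<close> is the sign, \<open>1\<close> or \<open>-1\<close>.\<close>

definition \<eta> :: "nat \<Rightarrow> complex \<Rightarrow> nat \<Rightarrow> state" where
  "\<eta> N s k = (\<lambda>x. ket N 0 k x + s * ket N 1 (\<alpha> N - k) x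
                 + s * (ket N 2 k x - s * ket N 3 (\<alpha> N - k) x))"

definition S5 :: "nat \<Rightarrow> state set" where
  "S5 N = {\<eta> N s k | s k. s \<in> {1, -1} \<and> k \<le> \<alpha> N}"

end

theory Submission
  imports Defs
begin

text \<open>
  The first party measures with \<open>|0\<rangle>\<langle>0| + |1\<rangle>\<langle>1|\<close> and \<open>|1\<rangle>\<langle>2| - |0\<rangle>\<langle>3|\<close>. Each outcome sends the
  set bijectively onto the complete orthogonal basis of \<open>N\<close>-qubit cat (GHZ) states
  \<open>|x\<rangle> \<plusminus> |x\<^sub>c\<rangle>\<close>, where \<open>x\<^sub>c\<close> is the bitwise complement of \<open>x\<close>.

  No LOCC protocol across a cut distinguishes this basis: the accumulated operator of a branch is a
  product across the cut, and at a leaf it must annihilate all basis states but one; its rows are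
  then product functionals proportional to an entangled state, hence zero, so that every branch would
  annihilate everything.

  For irreducibility, an orthogonality preserving measurement of one party \<open>j\<close> has
  \<open>M\<^sup>\<dagger> M \<otimes> I\<close> diagonal in the cat basis. Its matrix elements between two cat pairs, and between
  \<open>|x\<rangle> + |x\<^sub>c\<rangle>\<close> and \<open>|x\<rangle> - |x\<^sub>c\<rangle>\<close>, force it to be scalar. Inductively, every reachable operator
  multiplies all inner products by one constant, so it annihilates all states or none.
\<close>

subsection \<open>Configurations and local measurements\<close>

lemma finite_configs [simp]: "finite A \<Longrightarrow> finite (configs ds A)"
  unfolding configs_def by (intro finite_PiE) auto

lemma finite_parties [simp]: "finite (parties ds)"
  by (simp add: parties_def)

lemma configs_cong: "(\<And>i. i \<in> A \<Longrightarrow> ds' ! i = ds ! i) \<Longrightarrow> configs ds' A = configs ds A"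
  unfolding configs_def by (intro PiE_cong) auto

lemma configs_restrict: "x \<in> configs ds B \<Longrightarrow> A \<subseteq> B \<Longrightarrow> restrict x A \<in> configs ds A"
  unfolding configs_def by (auto simp: PiE_iff)

lemma configs_override:
  assumes "x \<in> configs ds' B" "y \<in> configs ds A" "A \<subseteq> B" "\<And>i. i \<in> B - A \<Longrightarrow> ds' ! i = ds ! i"
  shows "override_on x y A \<in> configs ds B"
  unfolding configs_def
proof (rule PiE_I)
  fix i assume "i \<in> B"
  then show "override_on x y A i \<in> {..<ds ! i}"
    using assms by (cases "i \<in> A") (auto simp: configs_def PiE_iff)
next
  fix i assume "i \<notin> B"
  then show "override_on x y A i = undefined"
    using assms unfolding configs_def by (metis PiE_arb override_on_apply_notin subsetD)
qed

lemma configs_eqI: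
  assumes "x \<in> configs ds B" "y \<in> configs ds' B" "A \<subseteq> B"
    "restrict x A = restrict y A" "restrict x (B - A) = restrict y (B - A)"
  shows "x = y"
proof
  fix i
  have "i \<in> A \<Longrightarrow> x i = y i" "i \<in> B - A \<Longrightarrow> x i = y i"
    using fun_cong[OF assms(4), of i] fun_cong[OF assms(5), of i] by simp_all
  moreover have "i \<notin> B \<Longrightarrow> x i = y i"
    using assms(1,2) unfolding configs_def by (metis PiE_arb)
  ultimately show "x i = y i" by blast
qed

text \<open>The bijection sends \<open>x\<close> to its two restrictions, and
  \<open>override_on\<close> glues them back together. Sums over a tensor product become double sums
  over its factors.\<close>

lemma sum_configs_split:
  assumes "finite B" "A \<subseteq> B"
  shows "(\<Sum>x\<in>configs ds B. F (restrict x A) (restrict x (B - A)))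
       = (\<Sum>u\<in>configs ds A. \<Sum>v\<in>configs ds (B - A). F u v)"
  unfolding sum.cartesian_product
proof (rule sum.reindex_bij_witness[where j = "\<lambda>x. (restrict x A, restrict x (B - A))"
      and i = "\<lambda>(u, v). override_on v u A"], goal_cases)
  case (1 x)
  then show ?case using assms
    by (auto simp: configs_def PiE_iff override_on_def extensional_def fun_eq_iff)
next
  case (2 x)
  then show ?case using assms configs_restrict[of x ds B] by auto
next
  case (3 p)
  then show ?case using assms
    by (auto simp: configs_def PiE_iff override_on_def extensional_def fun_eq_iff split: if_splits)
next
  case (4 p)
  then show ?case using assms
    by (auto simp: configs_def PiE_iff override_on_def extensional_def split: if_splits)
qed auto

lemma sum_configs_singleton:
  "(\<Sum>y\<in>configs ds {j}. F y) = (\<Sum>a<ds ! j. F (\<lambda>i\<in>{j}. a))"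
proof (rule sum.reindex_bij_witness[where j = "\<lambda>y. y j" and i = "\<lambda>a. \<lambda>i\<in>{j}. a"], goal_cases)
  case (1 y)
  then show ?case by (auto simp: configs_def PiE_iff extensional_def fun_eq_iff)
next
  case (5 y)
  then have "(\<lambda>i\<in>{j}. y j) = y" by (auto simp: configs_def PiE_iff extensional_def fun_eq_iff)
  then show ?case by simp
qed (auto simp: configs_def PiE_iff)

lemma sum_list_sum_swap:
  "(\<Sum>m\<leftarrow>ms. \<Sum>x\<in>X. f m x) = (\<Sum>x\<in>X. \<Sum>m\<leftarrow>ms. f m (x :: 'a) :: complex)"
  by (induction ms) (auto simp: sum.distrib)

lemma sum_list_mult_right: "(\<Sum>m\<leftarrow>ms. f m * c) = (\<Sum>m\<leftarrow>ms. f m) * (c :: complex)"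
  by (induction ms) (auto simp: algebra_simps)

section \<open>Inner products and weights under local operators and measurements\<close>

lemma norm_sq_braket: "of_real (norm_sq ds \<psi>) = braket ds \<psi> \<psi>"
  unfolding norm_sq_def braket_def of_real_sum
  by (intro sum.cong refl) (simp add: complex_norm_square[symmetric] mult.commute)

lemma norm_sq_nonneg: "norm_sq ds \<psi> \<ge> 0"
  unfolding norm_sq_def by (intro sum_nonneg) auto

lemma norm_sq_eq_0_iff:
  assumes "\<psi> \<in> vectors ds"
  shows "norm_sq ds \<psi> = 0 \<longleftrightarrow> \<psi> = zero_vector"
proof -
  have "norm_sq ds \<psi> = 0 \<longleftrightarrow> (\<forall>x\<in>configs ds (parties ds). \<psi> x = 0)"
    unfolding norm_sq_def by (subst sum_nonneg_eq_0_iff) auto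
  then show ?thesis using assms by (auto simp: vectors_def zero_vector_def)
qed

lemma apply_local_zero: "apply_local ds ds' A M zero_vector = zero_vector"
  by (auto simp: apply_local_def zero_vector_def)

text \<open>The operator enters only through the entries of M^dagger M on the measured parties, so
  completeness can be inserted after summing over outcomes.\<close>

lemma braket_apply_local:
  assumes A: "A \<subseteq> parties ds" and len: "length ds' = length ds"
    and d: "\<forall>i\<in>parties ds - A. ds' ! i = ds ! i"
  shows "braket ds' (apply_local ds ds' A M \<phi>) (apply_local ds ds' A M \<psi>) =
    (\<Sum>v\<in>configs ds (parties ds - A). \<Sum>y\<in>configs ds A. \<Sum>y'\<in>configs ds A.
      (\<Sum>u\<in>configs ds' A. cnj (M u y) * M u y') *
      (cnj (\<phi> (override_on v y A)) * \<psi> (override_on v y' A)))"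
proof -
  let ?P = "parties ds"
  have P: "parties ds' = ?P" using len by (simp add: parties_def)
  have "braket ds' (apply_local ds ds' A M \<phi>) (apply_local ds ds' A M \<psi>) =
    (\<Sum>x\<in>configs ds' ?P.
      (\<lambda>u v. \<Sum>y\<in>configs ds A. \<Sum>y'\<in>configs ds A. cnj (M u y) * M u y' *
      (cnj (\<phi> (override_on v y A)) * \<psi> (override_on v y' A))) (restrict x A) (restrict x (?P - A)))"
    unfolding braket_def P
  proof (intro sum.cong refl)
    fix x assume x: "x \<in> configs ds' ?P"
    \<comment> \<open>Overwriting on \<open>A\<close> forgets what \<open>x\<close> was there, so
      the summand depends on \<open>x\<close> through its two restrictions only, as
      \<open>sum_configs_split\<close> requires.\<close>
    have ov: "override_on x y A = override_on (restrict x (?P - A)) y A" for y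
      using x A by (auto simp: override_on_def configs_def PiE_iff extensional_def fun_eq_iff)
    show "cnj (apply_local ds ds' A M \<phi> x) * apply_local ds ds' A M \<psi> x =
      (\<lambda>u v. \<Sum>y\<in>configs ds A. \<Sum>y'\<in>configs ds A. cnj (M u y) * M u y' *
      (cnj (\<phi> (override_on v y A)) * \<psi> (override_on v y' A))) (restrict x A) (restrict x (?P - A))"
      using x unfolding apply_local_def P ov
      by (simp add: cnj_sum sum_product, intro sum.cong refl) (simp add: mult_ac)
  qed
  also have "\<dots> = (\<Sum>u\<in>configs ds' A. \<Sum>v\<in>configs ds' (?P - A).
      \<Sum>y\<in>configs ds A. \<Sum>y'\<in>configs ds A. cnj (M u y) * M u y' *
      (cnj (\<phi> (override_on v y A)) * \<psi> (override_on v y' A)))"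
    by (rule sum_configs_split) (use A in auto)
  also have "configs ds' (?P - A) = configs ds (?P - A)"
    by (rule configs_cong) (use d in auto)
  also have "(\<Sum>u\<in>configs ds' A. \<Sum>v\<in>configs ds (?P - A).
      \<Sum>y\<in>configs ds A. \<Sum>y'\<in>configs ds A. cnj (M u y) * M u y' *
      (cnj (\<phi> (override_on v y A)) * \<psi> (override_on v y' A))) =
    (\<Sum>v\<in>configs ds (?P - A). \<Sum>y\<in>configs ds A. \<Sum>y'\<in>configs ds A. \<Sum>u\<in>configs ds' A.
      cnj (M u y) * M u y' * (cnj (\<phi> (override_on v y A)) * \<psi> (override_on v y' A)))"
    by (rule trans[OF sum.swap], rule sum.cong[OF refl], rule trans[OF sum.swap],
        rule sum.cong[OF refl], rule sum.swap)
  finally show ?thesis by (simp add: sum_distrib_right)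
qed

text \<open>Polarized form of conservation of probability: summed over outcomes, M^dagger M becomes
  a Kronecker delta and the double sum over \<open>A\<close> collapses to its diagonal.\<close>

lemma measurement_braket:
  assumes A: "A \<subseteq> parties ds" and m: "measurement ds A Ms"
  shows "(\<Sum>(ds', M)\<leftarrow>Ms. braket ds' (apply_local ds ds' A M \<phi>) (apply_local ds ds' A M \<psi>))
    = braket ds \<phi> \<psi>"
proof -
  let ?P = "parties ds"
  let ?h = "\<lambda>v y y'. cnj (\<phi> (override_on v y A)) * \<psi> (override_on v y' A)"
  have fin: "finite A" using A finite_parties finite_subset by blast
  have "(\<Sum>(ds', M)\<leftarrow>Ms. braket ds' (apply_local ds ds' A M \<phi>) (apply_local ds ds' A M \<psi>)) =
    (\<Sum>m\<leftarrow>Ms. \<Sum>v\<in>configs ds (?P - A). \<Sum>y\<in>configs ds A. \<Sum>y'\<in>configs ds A.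
      (case m of (ds', M) \<Rightarrow> (\<Sum>u\<in>configs ds' A. cnj (M u y) * M u y')) * ?h v y y')"
  proof (intro arg_cong[where f = sum_list] map_cong refl)
    fix k assume k: "k \<in> set Ms"
    obtain ds' M where [simp]: "k = (ds', M)" by (cases k)
    have "length ds' = length ds \<and> (\<forall>i\<in>parties ds - A. ds' ! i = ds ! i)"
      using m k unfolding measurement_def by fastforce
    from braket_apply_local[OF A conjunct1[OF this] conjunct2[OF this]]
    show "(case k of (ds', M) \<Rightarrow>
        braket ds' (apply_local ds ds' A M \<phi>) (apply_local ds ds' A M \<psi>)) =
      (\<Sum>v\<in>configs ds (?P - A). \<Sum>y\<in>configs ds A. \<Sum>y'\<in>configs ds A.
      (case k of (ds', M) \<Rightarrow> (\<Sum>u\<in>configs ds' A. cnj (M u y) * M u y')) * ?h v y y')"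
      by simp
  qed
  also have "\<dots> = (\<Sum>v\<in>configs ds (?P - A). \<Sum>y\<in>configs ds A. \<Sum>y'\<in>configs ds A.
      (\<Sum>(ds', M)\<leftarrow>Ms. (\<Sum>u\<in>configs ds' A. cnj (M u y) * M u y')) * ?h v y y')"
    by (simp only: sum_list_sum_swap sum_list_mult_right)
  also have "\<dots> = (\<Sum>v\<in>configs ds (?P - A). \<Sum>y\<in>configs ds A. \<Sum>y'\<in>configs ds A.
      (if y = y' then 1 else 0) * ?h v y y')"
    using m unfolding measurement_def by (intro sum.cong refl) auto
  also have "\<dots> = (\<Sum>v\<in>configs ds (?P - A). \<Sum>y\<in>configs ds A. ?h v y y)"
    using fin by (simp add: if_distrib[where f = "\<lambda>c. c * _"] cong: if_cong)
  also have "\<dots> = (\<Sum>x\<in>configs ds ?P. (\<lambda>u v. ?h v u u) (restrict x A) (restrict x (?P - A)))"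
    by (subst sum.swap, rule sum_configs_split[symmetric]) (use A in auto)
  also have "\<dots> = braket ds \<phi> \<psi>"
    unfolding braket_def
  proof (intro sum.cong refl)
    fix x assume x: "x \<in> configs ds ?P"
    have "override_on (restrict x (?P - A)) (restrict x A) A = x"
      using x A by (auto simp: override_on_def configs_def PiE_iff extensional_def fun_eq_iff)
    then show "(\<lambda>u v. ?h v u u) (restrict x A) (restrict x (?P - A)) = cnj (\<phi> x) * \<psi> x"
      by simp
  qed
  finally show ?thesis .
qed

lemma measurement_norm_sq:
  assumes "A \<subseteq> parties ds" "measurement ds A Ms"
  shows "(\<Sum>a<length Ms. norm_sq (fst (Ms ! a))
      (apply_local ds (fst (Ms ! a)) A (snd (Ms ! a)) \<psi>)) = norm_sq ds \<psi>"
proof -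
  have "(of_real (\<Sum>a<length Ms. norm_sq (fst (Ms ! a))
      (apply_local ds (fst (Ms ! a)) A (snd (Ms ! a)) \<psi>)) :: complex)
    = (\<Sum>(ds', M)\<leftarrow>Ms. braket ds' (apply_local ds ds' A M \<psi>) (apply_local ds ds' A M \<psi>))"
    by (simp add: norm_sq_braket sum_list_sum_nth atLeast0LessThan case_prod_unfold)
  also have "\<dots> = of_real (norm_sq ds \<psi>)"
    using measurement_braket[OF assms] by (simp add: norm_sq_braket)
  finally show ?thesis by (simp only: of_real_eq_iff)
qed

text \<open>Each measurement conserves total weight, and a leaf assigns its weight to a single
  answer. A protocol attains this bound only if every branch does, which is how it is used
  below.\<close>

lemma answer_weight_le_norm_sq: "LOCC P p ds \<Longrightarrow> answer_weight r p ds \<psi> \<le> norm_sq ds \<psi>"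
proof (induction p arbitrary: ds \<psi>)
  case (Announce r')
  then show ?case by (simp add: norm_sq_nonneg)
next
  case (Measure A Ms cont)
  have "answer_weight r (Measure A Ms cont) ds \<psi> \<le> (\<Sum>a<length Ms. norm_sq (fst (Ms ! a))
      (apply_local ds (fst (Ms ! a)) A (snd (Ms ! a)) \<psi>))"
    using Measure by (auto intro!: sum_mono)
  also have "\<dots> = norm_sq ds \<psi>"
    by (rule measurement_norm_sq) (use Measure in auto)
  finally show ?case .
qed

subsection \<open>Operators that are products across a bipartition\<close>

definition tensor_op :: "nat list \<Rightarrow> nat list \<Rightarrow> nat set \<Rightarrow> operator \<Rightarrow> operator \<Rightarrow> state \<Rightarrow> state" where
  "tensor_op ds ds' A a b \<psi> = (\<lambda>x. if x \<in> configs ds' (parties ds') then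
     \<Sum>y\<in>configs ds (parties ds). a (restrict x A) (restrict y A) *
       b (restrict x (parties ds - A)) (restrict y (parties ds - A)) * \<psi> y else 0)"

text \<open>Agreement is demanded on \<open>vectors ds\<close> only, because
  \<open>tensor_op\<close> truncates to the index set while \<open>id\<close> does not.\<close>

definition is_tensor :: "nat list \<Rightarrow> nat list \<Rightarrow> nat set \<Rightarrow> (state \<Rightarrow> state) \<Rightarrow> bool" where
  "is_tensor ds ds' A K \<longleftrightarrow> (\<exists>a b. \<forall>\<psi>\<in>vectors ds. K \<psi> = tensor_op ds ds' A a b \<psi>)"

lemma tensor_op_swap:
  "A \<subseteq> parties ds \<Longrightarrow> tensor_op ds ds' (parties ds - A) b a \<psi> = tensor_op ds ds' A a b \<psi>"
  by (simp add: tensor_op_def double_diff mult_ac cong: if_cong)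

lemma is_tensor_swap:
  "A \<subseteq> parties ds \<Longrightarrow> is_tensor ds ds' A K \<Longrightarrow> is_tensor ds ds' (parties ds - A) K"
  unfolding is_tensor_def by (metis tensor_op_swap)

lemma is_tensor_id:
  assumes A: "A \<subseteq> parties ds"
  shows "is_tensor ds ds A id"
proof -
  let ?P = "parties ds"
  let ?d = "\<lambda>u v. if u = v then 1 else 0 :: complex"
  have "id \<psi> = tensor_op ds ds A ?d ?d \<psi>" if \<psi>: "\<psi> \<in> vectors ds" for \<psi>
  proof
    fix x
    show "id \<psi> x = tensor_op ds ds A ?d ?d \<psi> x"
    proof (cases "x \<in> configs ds ?P")
      case True
      have "?d (restrict x A) (restrict y A) * ?d (restrict x (?P - A)) (restrict y (?P - A)) * \<psi> y
        = (if x = y then \<psi> y else 0)" if "y \<in> configs ds ?P" for y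
        using configs_eqI[OF True that A] by auto
      then have "tensor_op ds ds A ?d ?d \<psi> x =
        (\<Sum>y\<in>configs ds ?P. if x = y then \<psi> y else 0)"
        unfolding tensor_op_def using True by simp
      then show ?thesis using True by simp
    qed (use \<psi> in \<open>auto simp: tensor_op_def vectors_def\<close>)
  qed
  then show ?thesis unfolding is_tensor_def by blast
qed

text \<open>An operation inside \<open>A\<close> is absorbed by the first factor. That the same
  \<open>b\<close> reappears lets a later argument compare the operators before and after a
  measurement.\<close>

lemma apply_local_tensor_op:
  assumes A: "A \<subseteq> parties ds" and C: "C \<subseteq> A" and len: "length ds' = length ds" "length ds'' = length ds"
    and d: "\<forall>i\<in>parties ds - C. ds'' ! i = ds' ! i"
  shows "\<exists>a'. \<forall>\<psi>. apply_local ds' ds'' C M (tensor_op ds ds' A a b \<psi>) = tensor_op ds ds'' A a' b \<psi>"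
proof (intro exI allI ext)
  let ?P = "parties ds"
  have P: "parties ds' = ?P" "parties ds'' = ?P" using len by (auto simp: parties_def)
  \<comment> \<open>The matrix product of \<open>M\<close>, extended by the identity to all of
    \<open>A\<close>, with \<open>a\<close>.\<close>
  let ?a = "\<lambda>u v. \<Sum>z\<in>configs ds' C. M (restrict u C) z * a (override_on u z C) v"
  fix \<psi> x
  show "apply_local ds' ds'' C M (tensor_op ds ds' A a b \<psi>) x = tensor_op ds ds'' A ?a b \<psi> x"
  proof (cases "x \<in> configs ds'' ?P")
    case x: True
    have ov: "override_on x z C \<in> configs ds' ?P"
      "restrict (override_on x z C) A = override_on (restrict x A) z C"
      "restrict (override_on x z C) (?P - A) = restrict x (?P - A)" if z: "z \<in> configs ds' C" for z
      using configs_override[OF x z] A C d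
      by (auto simp: override_on_def restrict_def fun_eq_iff)
    have rr: "restrict x (A \<inter> C) = restrict x C" using C by (simp add: Int_absorb1)
    have "apply_local ds' ds'' C M (tensor_op ds ds' A a b \<psi>) x =
      (\<Sum>z\<in>configs ds' C. \<Sum>y\<in>configs ds ?P. M (restrict x C) z *
         (a (override_on (restrict x A) z C) (restrict y A) *
         b (restrict x (?P - A)) (restrict y (?P - A)) * \<psi> y))"
      using x unfolding apply_local_def tensor_op_def P
      by (auto simp: ov sum_distrib_left intro!: sum.cong)
    also have "\<dots> = (\<Sum>y\<in>configs ds ?P. ?a (restrict x A) (restrict y A) *
         b (restrict x (?P - A)) (restrict y (?P - A)) * \<psi> y)"
      by (subst sum.swap) (simp add: rr sum_distrib_left mult_ac)
    finally show ?thesis using x by (simp add: tensor_op_def P)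
  qed (simp add: apply_local_def tensor_op_def P)
qed

lemma is_tensor_apply_local:
  assumes K: "is_tensor ds ds' A K" and A: "A \<subseteq> parties ds" and C: "C \<subseteq> A \<or> C \<subseteq> parties ds - A"
    and len: "length ds' = length ds" "length ds'' = length ds"
    and d: "\<forall>i\<in>parties ds - C. ds'' ! i = ds' ! i"
  shows "is_tensor ds ds'' A (apply_local ds' ds'' C M \<circ> K)"
proof -
  \<comment> \<open>The cut is generalized here so that the fact also applies to the complementary
    side, where the two factors exchange roles.\<close>
  have *: "is_tensor ds ds'' A (apply_local ds' ds'' C M \<circ> K)"
    if "is_tensor ds ds' A K" "A \<subseteq> parties ds" "C \<subseteq> A" for A
    using that apply_local_tensor_op[OF that(2,3) len d] unfolding is_tensor_def comp_def
    by metis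
  show ?thesis
  proof (cases "C \<subseteq> A")
    case True
    then show ?thesis using * K A by blast
  next
    case False
    then have "is_tensor ds ds'' (parties ds - A) (apply_local ds' ds'' C M \<circ> K)"
      using * is_tensor_swap[OF A K] C by blast
    from is_tensor_swap[OF _ this] show ?thesis using A by (simp add: double_diff)
  qed
qed

text \<open>The matrix a^dagger a; \<open>ds\<close> lists the output dimensions of
  \<open>a\<close>.\<close>

definition gram :: "nat list \<Rightarrow> nat set \<Rightarrow> operator \<Rightarrow> operator" where
  "gram ds A a u v = (\<Sum>x\<in>configs ds A. cnj (a x u) * a x v)"

text \<open>For a product operator, K^dagger K is the tensor product of the Gram matrices of its
  factors.\<close>

lemma braket_tensor_op:
  assumes A: "A \<subseteq> parties ds" and len: "length ds' = length ds"
  shows "braket ds' (tensor_op ds ds' A a b \<phi>) (tensor_op ds ds' A a b \<psi>) =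
    (\<Sum>y\<in>configs ds (parties ds). \<Sum>y'\<in>configs ds (parties ds).
      gram ds' A a (restrict y A) (restrict y' A) *
      gram ds' (parties ds - A) b (restrict y (parties ds - A)) (restrict y' (parties ds - A)) *
      (cnj (\<phi> y) * \<psi> y'))"
proof -
  let ?P = "parties ds"
  let ?A = "\<lambda>y. restrict y A" and ?B = "\<lambda>y. restrict y (?P - A)"
  have P: "parties ds' = ?P" using len by (auto simp: parties_def)
  have "braket ds' (tensor_op ds ds' A a b \<phi>) (tensor_op ds ds' A a b \<psi>) =
    (\<Sum>x\<in>configs ds' ?P. \<Sum>y\<in>configs ds ?P. \<Sum>y'\<in>configs ds ?P.
      (cnj (a (?A x) (?A y)) * a (?A x) (?A y')) * (cnj (b (?B x) (?B y)) * b (?B x) (?B y')) *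
      (cnj (\<phi> y) * \<psi> y'))"
    unfolding braket_def tensor_op_def P
    by (simp add: cnj_sum sum_product, intro sum.cong refl) (simp add: mult_ac)
  also have "\<dots> = (\<Sum>y\<in>configs ds ?P. \<Sum>y'\<in>configs ds ?P. \<Sum>x\<in>configs ds' ?P.
      (cnj (a (?A x) (?A y)) * a (?A x) (?A y')) * (cnj (b (?B x) (?B y)) * b (?B x) (?B y')) *
      (cnj (\<phi> y) * \<psi> y'))"
    by (rule trans[OF sum.swap], rule sum.cong[OF refl], rule sum.swap)
  also have "\<dots> = (\<Sum>y\<in>configs ds ?P. \<Sum>y'\<in>configs ds ?P.
      (\<Sum>u\<in>configs ds' A. \<Sum>v\<in>configs ds' (?P - A).
      (cnj (a u (?A y)) * a u (?A y')) * (cnj (b v (?B y)) * b v (?B y'))) *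
      (cnj (\<phi> y) * \<psi> y'))"
    using sum_configs_split[OF finite_parties A, of
      "\<lambda>u v. (cnj (a u (?A y)) * a u (?A y')) * (cnj (b v (?B y)) * b v (?B y'))" ds' for y y']
    by (simp add: sum_distrib_right[symmetric])
  finally show ?thesis by (simp add: gram_def sum_product)
qed

definition unit_vector :: "config \<Rightarrow> state" where
  "unit_vector y = (\<lambda>z. if z = y then 1 else 0)"

lemma unit_vector_vectors: "y \<in> configs ds (parties ds) \<Longrightarrow> unit_vector y \<in> vectors ds"
  by (auto simp: unit_vector_def vectors_def)

lemma braket_unit_vector:
  "y \<in> configs ds (parties ds) \<Longrightarrow> braket ds \<phi> (unit_vector y) = cnj (\<phi> y)"
  unfolding braket_def unit_vector_def
  by (simp add: if_distrib[where f = "\<lambda>c. _ * c"] cong: if_cong)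

text \<open>Unit vectors read off single entries of K^dagger K.\<close>

lemma braket_tensor_op_unit_vector:
  assumes A: "A \<subseteq> parties ds" and len: "length ds' = length ds"
    and y: "y \<in> configs ds (parties ds)" "y' \<in> configs ds (parties ds)"
  shows "braket ds' (tensor_op ds ds' A a b (unit_vector y)) (tensor_op ds ds' A a b (unit_vector y')) =
      gram ds' A a (restrict y A) (restrict y' A) *
      gram ds' (parties ds - A) b (restrict y (parties ds - A)) (restrict y' (parties ds - A))"
proof -
  have *: "g * (cnj (if P then 1 else 0) * (if Q then 1 else 0)) =
    (if Q then if P then g else 0 else 0)" for g P Q by simp
  show ?thesis
    unfolding braket_tensor_op[OF A len] unit_vector_def *
    using y by simp
qed

subsection \<open>The basis of cat states\<close>

abbreviation bitstrings :: "nat \<Rightarrow> config set" where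
  "bitstrings N \<equiv> configs (replicate N 2) {..<N}"

definition flip :: "nat \<Rightarrow> config \<Rightarrow> config" where
  "flip N x = (\<lambda>i\<in>{..<N}. 1 - x i)"

definition cat :: "nat \<Rightarrow> complex \<Rightarrow> config \<Rightarrow> state" where
  "cat N s x = (\<lambda>z. if z = x then 1 else if z = flip N x then s else 0)"

text \<open>The condition \<open>x 0 = 0\<close> picks one representative from each complementary
  pair of bit strings.\<close>

definition cats :: "nat \<Rightarrow> state set" where
  "cats N = {cat N s x | s x. s \<in> {1, -1} \<and> x \<in> bitstrings N \<and> x 0 = 0}"

lemma parties_replicate [simp]: "parties (replicate N d) = {..<N}"
  by (simp add: parties_def)

lemma bitstrings_iff:
  "x \<in> bitstrings N \<longleftrightarrow> (\<forall>i<N. x i = 0 \<or> x i = 1) \<and> (\<forall>i\<ge>N. x i = undefined)"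
  by (auto simp: configs_def PiE_iff extensional_def less_2_cases_iff numeral_2_eq_2 less_Suc_eq)

lemma flip_bitstrings: "x \<in> bitstrings N \<Longrightarrow> flip N x \<in> bitstrings N"
  by (auto simp: bitstrings_iff flip_def)

lemma flip_flip: "x \<in> bitstrings N \<Longrightarrow> flip N (flip N x) = x"
  by (auto simp: bitstrings_iff flip_def fun_eq_iff)

lemma flip_apply_neq: "x \<in> bitstrings N \<Longrightarrow> i < N \<Longrightarrow> flip N x i \<noteq> x i"
  by (auto simp: bitstrings_iff flip_def)

lemma flip_neq: "x \<in> bitstrings N \<Longrightarrow> N > 0 \<Longrightarrow> flip N x \<noteq> x"
  using flip_apply_neq by metis

lemma bitstrings_0_neq_flip:
  "x \<in> bitstrings N \<Longrightarrow> y \<in> bitstrings N \<Longrightarrow> N > 0 \<Longrightarrow> x 0 = y 0 \<Longrightarrow> x \<noteq> flip N y"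
  using flip_apply_neq by metis

lemma cat_vectors: "x \<in> bitstrings N \<Longrightarrow> cat N s x \<in> vectors (replicate N 2)"
  using flip_bitstrings by (auto simp: cat_def vectors_def)

lemma cats_vectors: "cats N \<subseteq> vectors (replicate N 2)"
  using cat_vectors by (auto simp: cats_def)

lemma cat_neq_zero: "cat N s x \<noteq> zero_vector"
proof
  assume "cat N s x = zero_vector"
  from fun_cong[OF this, of x] show False by (simp add: cat_def zero_vector_def)
qed

lemma sum_cat:
  assumes "x \<in> bitstrings N" "N > 0"
  shows "(\<Sum>y\<in>bitstrings N. h y * cat N s x y) = h x + s * h (flip N x)"
proof -
  have "h y * cat N s x y = (if y = x then h x else 0) + (if y = flip N x then s * h (flip N x) else 0)"
    for y using flip_neq[OF assms] by (auto simp: cat_def)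
  then show ?thesis using assms flip_bitstrings by (simp add: sum.distrib)
qed

lemma braket_cat:
  assumes "x \<in> bitstrings N" "N > 0"
  shows "braket (replicate N 2) \<phi> (cat N s x) = cnj (\<phi> x) + s * cnj (\<phi> (flip N x))"
  using sum_cat[OF assms, of "\<lambda>y. cnj (\<phi> y)"] by (simp add: braket_def)

text \<open>Different pairs have disjoint supports, since the leading bit tells \<open>x\<close>
  from any complement. Within one pair the signs are opposite and the product is 1 + s t =
  0.\<close>

lemma braket_cat_cat:
  assumes "x \<in> bitstrings N" "y \<in> bitstrings N" "N > 0" "x 0 = 0" "y 0 = 0"
    "s \<in> {1, -1}" "t \<in> {1, -1}" "(s, x) \<noteq> (t, y)"
  shows "braket (replicate N 2) (cat N s x) (cat N t y) = 0"
proof -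
  have "y \<noteq> flip N x" "x \<noteq> flip N y" "flip N x \<noteq> x" "flip N y \<noteq> y"
    using bitstrings_0_neq_flip flip_neq assms by metis+
  moreover have "flip N x = flip N y \<longleftrightarrow> x = y"
    using flip_flip assms by metis
  ultimately show ?thesis
    unfolding braket_cat[OF assms(2,3)] using assms(6-8) by (auto simp: cat_def)
qed

text \<open>Two equal states with different labels would be orthogonal to themselves, hence
  zero.\<close>

lemma cat_eq_iff:
  assumes "x \<in> bitstrings N" "y \<in> bitstrings N" "N > 0" "x 0 = 0" "y 0 = 0"
    "s \<in> {1, -1}" "t \<in> {1, -1}"
  shows "cat N s x = cat N t y \<longleftrightarrow> (s, x) = (t, y)"
proof
  assume eq: "cat N s x = cat N t y"
  show "(s, x) = (t, y)"
  proof (rule ccontr)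
    assume "(s, x) \<noteq> (t, y)"
    then have "norm_sq (replicate N 2) (cat N t y) = 0"
      using braket_cat_cat[OF assms] norm_sq_braket[of "replicate N 2" "cat N t y"] eq by simp
    then show False using norm_sq_eq_0_iff[OF cat_vectors[OF assms(2)]] cat_neq_zero by blast
  qed
qed simp

lemma mutually_orthogonal_cats: "N > 0 \<Longrightarrow> mutually_orthogonal_states (replicate N 2) (cats N)"
  unfolding mutually_orthogonal_states_def using cats_vectors[of N] cat_neq_zero
  by (auto simp: cats_def intro!: braket_cat_cat)

text \<open>The hybrid of \<open>x\<close> and its complement along a proper cut is the witness of
  entanglement: a product function nonzero at both strings is nonzero at the hybrid, where the cat
  state vanishes.\<close>

lemma mixed_bitstring:
  assumes x: "x \<in> bitstrings N" and A: "A \<noteq> {}" "A \<subset> {..<N}"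
  defines "m \<equiv> override_on (flip N x) x A"
  shows "m \<in> bitstrings N" "m \<noteq> x" "m \<noteq> flip N x"
    "restrict m A = restrict x A" "restrict m ({..<N} - A) = restrict (flip N x) ({..<N} - A)"
proof -
  show "m \<in> bitstrings N"
    using x A by (auto simp: bitstrings_iff m_def override_on_def flip_def)
  obtain i j where ij: "i \<in> A" "i < N" "j \<notin> A" "j < N" using A by auto
  have "m i = x i" "m j = flip N x j" using ij by (auto simp: m_def)
  then show "m \<noteq> x" "m \<noteq> flip N x" using flip_apply_neq[OF x] ij by metis+
  show "restrict m A = restrict x A" "restrict m ({..<N} - A) = restrict (flip N x) ({..<N} - A)"
    by (auto simp: m_def restrict_def fun_eq_iff)
qed

lemma cat_genuinely_entangled:
  assumes x: "x \<in> bitstrings N" and N: "N > 0" and s: "s \<noteq> 0"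
  shows "genuinely_entangled (replicate N 2) (cat N s x)"
  unfolding genuinely_entangled_def product_across_def parties_replicate
proof (intro allI impI notI)
  fix A assume A: "A \<noteq> {} \<and> A \<subset> {..<N}"
  assume "\<exists>f g. \<forall>y\<in>bitstrings N. cat N s x y = f (restrict y A) * g (restrict y ({..<N} - A))"
  then obtain f g where fg:
    "\<And>y. y \<in> bitstrings N \<Longrightarrow> cat N s x y = f (restrict y A) * g (restrict y ({..<N} - A))" by blast
  note m = mixed_bitstring[OF x A[THEN conjunct1] A[THEN conjunct2]]
  have "cat N s x x \<noteq> 0" "cat N s x (flip N x) \<noteq> 0" using s by (auto simp: cat_def)
  \<comment> \<open>One factor is taken from the value at \<open>x\<close>, the other from the value
    at the complement; their product is the value at the hybrid.\<close>
  then have "f (restrict x A) * g (restrict (flip N x) ({..<N} - A)) \<noteq> 0"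
    using fg[OF x] fg[OF flip_bitstrings[OF x]] by auto
  moreover have "cat N s x (override_on (flip N x) x A) = 0"
    using m(2,3) by (simp add: cat_def)
  ultimately show False using fg[OF m(1)] m(4,5) by simp
qed

text \<open>The cat states span, so a functional that vanishes on all of them but \<open>r\<close> is a multiple of
  \<open>\<langle>r|\<close>; as \<open>r\<close> is entangled, a product functional of this kind is zero.\<close>

lemma product_functional_vanishes:
  assumes N: "N > 0" and A: "A \<noteq> {}" "A \<subset> {..<N}"
    and h: "\<And>y. y \<in> bitstrings N \<Longrightarrow> h y = f (restrict y A) * g (restrict y ({..<N} - A))"
    and zero: "\<And>\<psi>. \<psi> \<in> cats N \<Longrightarrow> \<psi> \<noteq> r \<Longrightarrow> (\<Sum>y\<in>bitstrings N. h y * \<psi> y) = 0"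
    and \<psi>: "\<psi> \<in> cats N"
  shows "(\<Sum>y\<in>bitstrings N. h y * \<psi> y) = 0"
proof (cases "\<psi> = r")
  case True
  obtain s x where sx: "\<psi> = cat N s x" "s \<in> {1, -1}" "x \<in> bitstrings N" "x 0 = 0"
    using \<psi> by (auto simp: cats_def)
  have fx: "flip N x \<in> bitstrings N" using flip_bitstrings sx(3) by simp
  have hz: "h y + t * h (flip N y) = 0"
    if "y \<in> bitstrings N" "y 0 = 0" "t \<in> {1, -1}" "(t, y) \<noteq> (s, x)" for t y
    using zero[of "cat N t y"] cat_eq_iff[OF that(1) sx(3) N that(2) sx(4) that(3) sx(2)] that sum_cat[OF that(1) N] True sx(1)
    by (auto simp: cats_def)
  \<comment> \<open>Away from the pair of \<open>r\<close>, both sign equations are available; their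
    sum and difference isolate the two values.\<close>
  have off0: "h y = 0 \<and> h (flip N y) = 0" if "y \<in> bitstrings N" "y 0 = 0" "y \<noteq> x" for y
    using hz[OF that(1,2), of 1] hz[OF that(1,2), of "-1"] that(3) by simp
  have off: "h y = 0" if y: "y \<in> bitstrings N" "y \<noteq> x" "y \<noteq> flip N x" for y
  proof (cases "y 0 = 0")
    case False
    then have "flip N y 0 = 0" using y N by (auto simp: bitstrings_iff flip_def)
    with off0[OF flip_bitstrings[OF y(1)]] y flip_flip show ?thesis by metis
  qed (use off0 y in blast)
  \<comment> \<open>The product form allows the parts off \<open>A\<close> to be exchanged, which
    replaces \<open>x\<close> and its complement by the two hybrids.\<close>
  have "h x * h (flip N x) = h (override_on (flip N x) x A) * h (override_on x (flip N x) A)"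
    using mixed_bitstring[OF sx(3) A] mixed_bitstring[OF fx A] flip_flip[OF sx(3)]
      h[OF sx(3)] h[OF fx] by (simp add: h)
  also have "\<dots> = 0" using off[OF mixed_bitstring(1-3)[OF sx(3) A]] by simp
  finally have "h x * h (flip N x) = 0" .
  \<comment> \<open>The partner of \<open>r\<close> with the opposite sign is also annihilated, so
    the two values agree up to sign; as their product is zero, both vanish.\<close>
  moreover have "h x + (-s) * h (flip N x) = 0"
    using sx by (intro hz) auto
  ultimately have "h x = 0" "h (flip N x) = 0" using sx(2) by auto
  then show ?thesis using sum_cat[OF sx(3) N] sx(1) by simp
qed (use zero \<psi> in blast)

text \<open>Applied row by row: for fixed \<open>x\<close> the row of a product operator is a
  product functional.\<close>

lemma tensor_op_vanishes:
  assumes N: "N > 0" and A: "A \<noteq> {}" "A \<subset> {..<N}"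
    and zero: "\<And>\<psi>. \<psi> \<in> cats N \<Longrightarrow> \<psi> \<noteq> r \<Longrightarrow> tensor_op (replicate N 2) ds A a b \<psi> = zero_vector"
    and \<psi>: "\<psi> \<in> cats N"
  shows "tensor_op (replicate N 2) ds A a b \<psi> = zero_vector"
proof
  fix x
  let ?B = "{..<N} - A"
  let ?h = "\<lambda>y. a (restrict x A) (restrict y A) * b (restrict x ?B) (restrict y ?B)"
  show "tensor_op (replicate N 2) ds A a b \<psi> x = zero_vector x"
  proof (cases "x \<in> configs ds (parties ds)")
    case True
    have *: "tensor_op (replicate N 2) ds A a b \<phi> x = (\<Sum>y\<in>bitstrings N. ?h y * \<phi> y)" for \<phi>
      using True by (simp add: tensor_op_def)
    have "(\<Sum>y\<in>bitstrings N. ?h y * \<psi> y) = 0"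
      by (rule product_functional_vanishes[OF N A _ _ \<psi>, where r = r,
            where f = "a (restrict x A)" and g = "b (restrict x ?B)"])
        (auto simp: *[symmetric] zero zero_vector_def)
    then show ?thesis by (simp only: *) (simp add: zero_vector_def)
  qed (simp add: tensor_op_def zero_vector_def)
qed

section \<open>LOCC protocols across a cut\<close>

lemma tensor_op_vectors: "tensor_op ds ds' A a b \<psi> \<in> vectors ds'"
  by (auto simp: tensor_op_def vectors_def)

text \<open>Induction over the protocol, generalized from the identity to the operator
  \<open>K\<close> accumulated so far. The weight hypothesis says that the right answer receives all
  of the weight that reaches the current node.\<close>

lemma perfect_protocol_annihilates_cats:
  assumes N: "N > 0" and A: "A \<noteq> {}" "A \<subset> {..<N}"
    and "LOCC {A, {..<N} - A} p ds" "length ds = N" "is_tensor (replicate N 2) ds A K"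
    and "\<And>\<psi>. \<psi> \<in> cats N \<Longrightarrow> answer_weight \<psi> p ds (K \<psi>) = norm_sq ds (K \<psi>)"
    and "\<psi> \<in> cats N"
  shows "K \<psi> = zero_vector"
  using assms(4-)
proof (induction p arbitrary: ds K \<psi>)
  case (Announce r)
  obtain a b where K: "\<And>\<psi>. \<psi> \<in> cats N \<Longrightarrow> K \<psi> = tensor_op (replicate N 2) ds A a b \<psi>"
    using Announce.prems(3) cats_vectors unfolding is_tensor_def by blast
  \<comment> \<open>At a leaf announcing \<open>r\<close>, any other state has weight 0 for its own
    answer, so by perfection its norm is already 0.\<close>
  have "tensor_op (replicate N 2) ds A a b \<phi> = zero_vector" if "\<phi> \<in> cats N" "\<phi> \<noteq> r" for \<phi>
  proof -
    have "norm_sq ds (K \<phi>) = 0" using Announce.prems(4)[OF that(1)] that(2) by simp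
    then show ?thesis using K[OF that(1)] norm_sq_eq_0_iff[OF tensor_op_vectors] by metis
  qed
  from tensor_op_vanishes[OF N A this] show ?case using K Announce.prems(5) by metis
next
  case (Measure C Ms cont)
  let ?ds = "\<lambda>a. fst (Ms ! a)"
  let ?M = "\<lambda>a. apply_local ds (?ds a) C (snd (Ms ! a))"
  have C: "C = A \<or> C = {..<N} - A" and P: "C \<subseteq> parties ds" and m: "measurement ds C Ms"
    and L: "\<And>a. a < length Ms \<Longrightarrow> LOCC {A, {..<N} - A} (cont a) (?ds a)"
    using Measure.prems(1) by auto
  have PN: "parties ds = {..<N}" using Measure.prems(2) by (simp add: parties_def)
  have len: "length (?ds a) = N" and dd: "\<forall>i\<in>{..<N} - C. ?ds a ! i = ds ! i"
    if "a < length Ms" for a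
  proof -
    have "(?ds a, snd (Ms ! a)) \<in> set Ms" using nth_mem[OF that] by simp
    with m have "length (?ds a) = length ds \<and> (\<forall>i\<in>parties ds - C. ?ds a ! i = ds ! i)"
      unfolding measurement_def by blast
    then show "length (?ds a) = N" "\<forall>i\<in>{..<N} - C. ?ds a ! i = ds ! i"
      using Measure.prems(2) by (simp_all add: PN)
  qed
  have "(?M a \<circ> K) \<phi> = zero_vector" if a: "a < length Ms" and \<phi>: "\<phi> \<in> cats N" for a \<phi>
  proof (rule Measure.IH[where ds = "?ds a" and K = "?M a \<circ> K"])
    show "cont a \<in> range cont" by simp
    show "LOCC {A, {..<N} - A} (cont a) (?ds a)" using L a .
    show "length (?ds a) = N" using len a .
    show "is_tensor (replicate N 2) (?ds a) A (?M a \<circ> K)"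
      using Measure.prems(2,3) len[OF a] dd[OF a] C A
      by (intro is_tensor_apply_local) auto
    show "answer_weight \<psi> (cont a) (?ds a) ((?M a \<circ> K) \<psi>) = norm_sq (?ds a) ((?M a \<circ> K) \<psi>)"
      if \<psi>: "\<psi> \<in> cats N" for \<psi>
    \<comment> \<open>Perfection passes to each branch: a deficit in one branch cannot be made up by
      the others, each of which is bounded by its own weight.\<close>
    proof (rule ccontr)
      assume "answer_weight \<psi> (cont a) (?ds a) ((?M a \<circ> K) \<psi>) \<noteq> norm_sq (?ds a) ((?M a \<circ> K) \<psi>)"
      then have "answer_weight \<psi> (cont a) (?ds a) (?M a (K \<psi>)) < norm_sq (?ds a) (?M a (K \<psi>))"
        using answer_weight_le_norm_sq[OF L[OF a]] by (simp add: less_le)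
      then have "(\<Sum>a<length Ms. answer_weight \<psi> (cont a) (?ds a) (?M a (K \<psi>)))
        < (\<Sum>a<length Ms. norm_sq (?ds a) (?M a (K \<psi>)))"
        using a answer_weight_le_norm_sq[OF L] by (intro sum_strict_mono_ex1) auto
      also have "\<dots> = norm_sq ds (K \<psi>)" by (rule measurement_norm_sq[OF P m])
      finally show False using Measure.prems(4)[OF \<psi>] by simp
    qed
  qed (use a \<phi> in auto)
  \<comment> \<open>The weights of the branches add up to that of \<open>K \<psi>\<close>, and all
    of them are now 0.\<close>
  then have "norm_sq ds (K \<psi>) = 0"
    using measurement_norm_sq[OF P m, of "K \<psi>"] Measure.prems(5)
    by (simp add: norm_sq_def zero_vector_def)
  moreover have "K \<psi> \<in> vectors ds"
    using Measure.prems(3,5) cats_vectors tensor_op_vectors unfolding is_tensor_def by (metis subsetD)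
  ultimately show ?case using norm_sq_eq_0_iff by blast
qed

lemma bitstring_zero: "(\<lambda>i\<in>{..<N}. 0) \<in> bitstrings N"
  by (simp add: bitstrings_iff)

text \<open>A perfect protocol, started with the identity as accumulated operator, would force
  nonzero cat states to be zero.\<close>

lemma cats_LOCC_indistinguishable:
  assumes A: "A \<noteq> {}" "A \<subset> {..<N}"
  shows "LOCC_indistinguishable {A, {..<N} - A} (replicate N 2) (cats N)"
proof -
  have N: "N > 0" using A by (cases N) auto
  have "\<not> LOCC_distinguishable {A, {..<N} - A} (replicate N 2) (cats N)"
  proof
    assume "LOCC_distinguishable {A, {..<N} - A} (replicate N 2) (cats N)"
    then obtain p where p: "LOCC {A, {..<N} - A} p (replicate N 2)"
      "\<And>\<psi>. \<psi> \<in> cats N \<Longrightarrow> answer_prob \<psi> p (replicate N 2) \<psi> = 1"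
      unfolding LOCC_distinguishable_def by blast
    have "id \<psi> = zero_vector" if "\<psi> \<in> cats N" for \<psi>
    proof (rule perfect_protocol_annihilates_cats[OF N A p(1) _ _ _ that])
      show "is_tensor (replicate N 2) (replicate N 2) A id" using A by (intro is_tensor_id) auto
      show "answer_weight \<phi> p (replicate N 2) (id \<phi>) = norm_sq (replicate N 2) (id \<phi>)"
        if "\<phi> \<in> cats N" for \<phi>
        using p(2)[OF that] by (simp add: answer_prob_def divide_eq_1_iff)
    qed simp
    moreover have "cat N 1 (\<lambda>i\<in>{..<N}. 0) \<in> cats N"
      using bitstring_zero N unfolding cats_def by fastforce
    ultimately show False using cat_neq_zero by auto
  qed
  then show ?thesis using mutually_orthogonal_cats[OF N] unfolding LOCC_indistinguishable_def by simp
qed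

subsection \<open>Irreducibility of the cat basis\<close>

text \<open>\<open>G\<close> holds the entries of M^dagger M on party \<open>j\<close>, tensored
  with a scalar on the rest. \<open>orth\<close> makes it diagonal in the cat basis;
  \<open>anti\<close> and \<open>diag\<close> express the tensor form. Off-diagonal entries vanish,
  and complementing a string, which changes bit \<open>j\<close>, equates the two possible diagonal
  values.\<close>

lemma cats_orthogonal_imp_scalar:
  assumes N: "N > 0" and j: "j < N"
    and orth: "\<And>s t x y. s \<in> {1, -1} \<Longrightarrow> t \<in> {1, -1} \<Longrightarrow> x \<in> bitstrings N \<Longrightarrow> y \<in> bitstrings N \<Longrightarrow>
      x 0 = 0 \<Longrightarrow> y 0 = 0 \<Longrightarrow> (s, x) \<noteq> (t, y) \<Longrightarrow>
      G x y + t * G x (flip N y) + s * (G (flip N x) y + t * G (flip N x) (flip N y)) = 0"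
    and anti: "\<And>x. x \<in> bitstrings N \<Longrightarrow> G x (flip N x) = 0"
    and diag: "\<And>x y. x \<in> bitstrings N \<Longrightarrow> y \<in> bitstrings N \<Longrightarrow> x j = y j \<Longrightarrow> G x x = G y y"
  shows "\<exists>c::complex. \<forall>x\<in>bitstrings N. \<forall>y\<in>bitstrings N. G x y = (if x = y then c else 0)"
proof -
  have rep: "\<exists>x. x \<in> bitstrings N \<and> x 0 = 0 \<and> (z = x \<or> z = flip N x)" if z: "z \<in> bitstrings N" for z
  proof (cases "z 0 = 0")
    case False
    then have "flip N z 0 = 0" using z N by (auto simp: bitstrings_iff flip_def)
    then show ?thesis using flip_bitstrings[OF z] flip_flip[OF z] by metis
  qed (use z in blast)
  have flip_diag: "G (flip N z) (flip N z) = G z z" if z: "z \<in> bitstrings N" for z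
  proof -
    obtain x where x: "x \<in> bitstrings N" "x 0 = 0" "z = x \<or> z = flip N x" using rep[OF z] by blast
    have "G (flip N x) x = 0" using anti[OF flip_bitstrings[OF x(1)]] flip_flip[OF x(1)] by simp
    \<comment> \<open>Orthogonality of the two cat states of one pair leaves just the difference of
      the two diagonal entries.\<close>
    then have "G (flip N x) (flip N x) = G x x"
      using orth[of 1 "-1" x x] anti[OF x(1)] x by simp
    then show ?thesis using x(3) flip_flip[OF x(1)] by auto
  qed
  have off: "G z w = 0" if z: "z \<in> bitstrings N" and w: "w \<in> bitstrings N" and ne: "z \<noteq> w" for z w
  proof -
    obtain x where x: "x \<in> bitstrings N" "x 0 = 0" "z = x \<or> z = flip N x" using rep[OF z] by blast
    obtain y where y: "y \<in> bitstrings N" "y 0 = 0" "w = y \<or> w = flip N y" using rep[OF w] by blast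
    show ?thesis
    proof (cases "x = y")
      case True
      then show ?thesis using x y ne anti flip_flip[OF x(1)] flip_bitstrings[OF x(1)] by metis
    next
      case False
      define p q r u where "p = G x y" "q = G x (flip N y)" "r = G (flip N x) y"
        "u = G (flip N x) (flip N y)"
      have h: "p + t * q + s * (r + t * u) = 0" if "s \<in> {1, -1}" "t \<in> {1, -1}" for s t
        unfolding p_q_r_u_def using orth[OF that x(1) y(1) x(2) y(2)] False by simp
      have e: "p + q + r + u = 0" "p - q + r - u = 0" "p + q - r - u = 0" "p - q - r + u = 0"
        subgoal using h[of 1 1] by (simp add: algebra_simps)
        subgoal using h[of 1 "-1"] by (simp add: algebra_simps)
        subgoal using h[of "-1" 1] by (simp add: algebra_simps)
        subgoal using h[of "-1" "-1"] by (simp add: algebra_simps)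
        done
      \<comment> \<open>The four sign choices give a system with a Hadamard matrix, inverted here
        explicitly.\<close>
      have "4 * p = (p + q + r + u) + (p - q + r - u) + (p + q - r - u) + (p - q - r + u)"
        "4 * q = (p + q + r + u) - (p - q + r - u) + (p + q - r - u) - (p - q - r + u)"
        "4 * r = (p + q + r + u) + (p - q + r - u) - (p + q - r - u) - (p - q - r + u)"
        "4 * u = (p + q + r + u) - (p - q + r - u) - (p + q - r - u) + (p - q - r + u)"
        by (simp_all add: algebra_simps)
      then have "p = 0 \<and> q = 0 \<and> r = 0 \<and> u = 0" unfolding e by simp
      then show ?thesis using x(3) y(3) unfolding p_q_r_u_def by metis
    qed
  qed
  have "G x x = G y y" if x: "x \<in> bitstrings N" and y: "y \<in> bitstrings N" for x y
  proof (cases "x j = y j")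
    case False
    moreover have "z j = 0 \<or> z j = 1" if "z \<in> bitstrings N" for z
      using that j by (simp add: bitstrings_iff)
    note this[OF x] this[OF y] this[OF flip_bitstrings[OF y]]
    ultimately have "x j = flip N y j" using flip_apply_neq[OF y j] by auto
    then show ?thesis using diag[OF x flip_bitstrings[OF y]] flip_diag[OF y] by simp
  qed (use diag x y in blast)
  then show ?thesis using off by metis
qed

lemma sum_sum_cat:
  assumes "x \<in> bitstrings N" "y \<in> bitstrings N" "N > 0" "s \<in> {1, -1}"
  shows "(\<Sum>z\<in>bitstrings N. \<Sum>w\<in>bitstrings N. G z w * (cnj (cat N s x z) * cat N t y w))
    = G x y + t * G x (flip N y) + s * (G (flip N x) y + t * G (flip N x) (flip N y))"
proof -
  have "cnj (cat N s x z) = cat N s x z" for z using assms(4) by (auto simp: cat_def)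
  then have "(\<Sum>z\<in>bitstrings N. \<Sum>w\<in>bitstrings N. G z w * (cnj (cat N s x z) * cat N t y w))
    = (\<Sum>z\<in>bitstrings N. (\<Sum>w\<in>bitstrings N. G z w * cat N t y w) * cat N s x z)"
    by (simp add: sum_distrib_left mult_ac)
  also have "\<dots> = G x y + t * G x (flip N y) + s * (G (flip N x) y + t * G (flip N x) (flip N y))"
    by (simp add: sum_cat assms)
  finally show ?thesis .
qed

lemma braket_sum_delta:
  "(\<Sum>y\<in>configs ds (parties ds). \<Sum>y'\<in>configs ds (parties ds).
      (if y = y' then c else 0) * (cnj (\<phi> y) * \<psi> y')) = c * braket ds \<phi> \<psi>"
proof -
  have "(if y = y' then c else 0) * (cnj (\<phi> y) * \<psi> y')
    = (if y = y' then c * (cnj (\<phi> y) * \<psi> y') else 0)" for y y' by simp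
  then show ?thesis by (simp add: braket_def sum_distrib_left)
qed

text \<open>With respect to the cut \<open>{j}\<close> against the rest, \<open>K\<^sup>\<dagger> K\<close> and
  \<open>(M K)\<^sup>\<dagger> (M K)\<close> have the same second tensor factor, which is scalar because \<open>K\<^sup>\<dagger> K\<close> is.\<close>

lemma OPM_step_scalar:
  assumes N: "N \<ge> 2" and j: "j < N" and len: "length ds' = N" "length ds'' = N"
    and d: "\<forall>i\<in>{..<N} - {j}. ds'' ! i = ds' ! i"
    and K: "is_tensor (replicate N 2) ds' {j} K"
    and c: "\<And>\<phi> \<psi>. \<phi> \<in> vectors (replicate N 2) \<Longrightarrow> \<psi> \<in> vectors (replicate N 2) \<Longrightarrow>
      braket ds' (K \<phi>) (K \<psi>) = c * braket (replicate N 2) \<phi> \<psi>"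
    and c0: "c \<noteq> 0"
    and orth: "\<And>\<phi> \<psi>. \<phi> \<in> cats N \<Longrightarrow> \<psi> \<in> cats N \<Longrightarrow> \<phi> \<noteq> \<psi> \<Longrightarrow>
      braket ds'' (apply_local ds' ds'' {j} M (K \<phi>)) (apply_local ds' ds'' {j} M (K \<psi>)) = 0"
  shows "\<exists>c'. \<forall>\<phi>\<in>vectors (replicate N 2). \<forall>\<psi>\<in>vectors (replicate N 2).
      braket ds'' (apply_local ds' ds'' {j} M (K \<phi>)) (apply_local ds' ds'' {j} M (K \<psi>))
      = c' * braket (replicate N 2) \<phi> \<psi>"
proof -
  let ?Q = "replicate N (2::nat)"
  let ?B = "{..<N} - {j}"
  let ?A = "\<lambda>y. restrict y {j}" and ?R = "\<lambda>y. restrict y ?B"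
  have jN: "{j} \<subseteq> parties ?Q" using j by simp
  obtain a b where Kab: "\<And>\<psi>. \<psi> \<in> vectors ?Q \<Longrightarrow> K \<psi> = tensor_op ?Q ds' {j} a b \<psi>"
    using K unfolding is_tensor_def by blast
  obtain a' where a': "\<And>\<psi>. apply_local ds' ds'' {j} M (tensor_op ?Q ds' {j} a b \<psi>)
      = tensor_op ?Q ds'' {j} a' b \<psi>"
    using apply_local_tensor_op[OF jN order_refl] len d by (metis length_replicate parties_replicate)
  \<comment> \<open>The measurement changes only the dimension of party \<open>j\<close>, so the
    Gram matrix of \<open>b\<close> is the same before and after.\<close>
  have gramB: "gram ds'' ?B b = gram ds' ?B b"
    using configs_cong[of ?B ds'' ds'] d by (auto simp: gram_def fun_eq_iff)
  define F where "F = gram ds' ?B b"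
  define E where "E = gram ds' {j} a"
  define E' where "E' = gram ds'' {j} a'"
  define G where "G y y' = E' (?A y) (?A y') * F (?R y) (?R y')" for y y'
  have br: "braket ds'' (apply_local ds' ds'' {j} M (K \<phi>)) (apply_local ds' ds'' {j} M (K \<psi>)) =
      (\<Sum>y\<in>bitstrings N. \<Sum>y'\<in>bitstrings N. G y y' * (cnj (\<phi> y) * \<psi> y'))"
    if "\<phi> \<in> vectors ?Q" "\<psi> \<in> vectors ?Q" for \<phi> \<psi>
    using braket_tensor_op[OF jN, of ds'' a' b \<phi> \<psi>] len that
    by (simp add: Kab a' G_def E'_def F_def gramB)
  have EF: "E (?A y) (?A y') * F (?R y) (?R y') = (if y = y' then c else 0)"
    if "y \<in> bitstrings N" "y' \<in> bitstrings N" for y y'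
  proof -
    have y: "y \<in> configs ?Q (parties ?Q)" "y' \<in> configs ?Q (parties ?Q)" using that by auto
    have "E (?A y) (?A y') * F (?R y) (?R y') = braket ds' (K (unit_vector y)) (K (unit_vector y'))"
      using braket_tensor_op_unit_vector[OF jN _ y, of ds' a b] len
      by (simp add: Kab unit_vector_vectors[OF y(1)] unit_vector_vectors[OF y(2)] E_def F_def)
    also have "\<dots> = c * braket ?Q (unit_vector y) (unit_vector y')"
      using c unit_vector_vectors y by blast
    finally show ?thesis unfolding braket_unit_vector[OF y(2)] by (simp add: unit_vector_def)
  qed
  define o0 where "o0 = (\<lambda>i\<in>{..<N}. 0::nat)"
  have o0: "o0 \<in> bitstrings N" unfolding o0_def by (rule bitstring_zero)
  \<comment> \<open>The entries of K^dagger K are those of \<open>E\<close> times those of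
    \<open>F\<close>, equal to \<open>c\<close> times the identity. Fixing bit \<open>j\<close> to 0
    freezes the factor \<open>e\<close> and exposes \<open>F\<close> as \<open>c / e\<close> times
    the identity.\<close>
  define e where "e = E (?A o0) (?A o0)"
  have e0: "e \<noteq> 0" using EF[OF o0 o0] c0 by (auto simp: e_def)
  have F: "F (?R y) (?R y') = (if ?R y = ?R y' then c / e else 0)"
    if y: "y \<in> bitstrings N" "y' \<in> bitstrings N" for y y'
  proof -
    let ?o = "\<lambda>y. override_on y o0 {j}"
    have ob: "?o y \<in> bitstrings N" if "y \<in> bitstrings N" for y
      using that o0 j by (auto simp: bitstrings_iff override_on_def)
    have oA: "?A (?o y) = ?A o0" and oR: "?R (?o y) = ?R y" for y
      by (auto simp: restrict_def fun_eq_iff override_on_def)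
    have "?o y = ?o y' \<longleftrightarrow> ?R y = ?R y'"
      using configs_eqI[OF ob[OF y(1)] ob[OF y(2)], of "{j}"] oA oR j
      by (metis parties_replicate jN)
    moreover have "e * F (?R y) (?R y') = (if ?o y = ?o y' then c else 0)"
      using EF[OF ob[OF y(1)] ob[OF y(2)]] unfolding oA oR e_def .
    ultimately show ?thesis using e0 by (auto simp: field_simps)
  qed
  \<comment> \<open>A second party, which \<open>N \<ge> 2\<close> supplies: complementary strings
    differ there, so they differ off \<open>j\<close> and \<open>F\<close> vanishes between
    them.\<close>
  obtain i where i: "i < N" "i \<noteq> j" using N j
    by (metis One_nat_def less_2_cases_iff less_le_trans zero_neq_one)
  have "\<exists>c'. \<forall>x\<in>bitstrings N. \<forall>y\<in>bitstrings N. G x y = (if x = y then c' else 0)"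
  proof (rule cats_orthogonal_imp_scalar[OF _ j])
    show "N > 0" using N by simp
  next
    fix s t :: complex and x y
    assume *: "s \<in> {1, -1}" "t \<in> {1, -1}" "x \<in> bitstrings N" "y \<in> bitstrings N"
      "x 0 = 0" "y 0 = 0" "(s, x) \<noteq> (t, y)"
    have N0: "N > 0" using N by simp
    have in_cats: "cat N s x \<in> cats N" "cat N t y \<in> cats N" using * by (auto simp: cats_def)
    have "cat N s x \<noteq> cat N t y" using cat_eq_iff[OF *(3,4) N0 *(5,6,1,2)] *(7) by simp
    then show "G x y + t * G x (flip N y) + s * (G (flip N x) y + t * G (flip N x) (flip N y)) = 0"
      using orth[OF in_cats] br[OF subsetD[OF cats_vectors in_cats(1)] subsetD[OF cats_vectors in_cats(2)]]
        sum_sum_cat[OF *(3,4) N0 *(1), of G t] by simp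
  next
    fix x assume x: "x \<in> bitstrings N"
    have "?R x i \<noteq> ?R (flip N x) i" using flip_apply_neq[OF x i(1)] i by simp
    then have "?R x \<noteq> ?R (flip N x)" by metis
    then show "G x (flip N x) = 0" using F[OF x flip_bitstrings[OF x]] by (simp add: G_def)
  next
    fix x y assume x: "x \<in> bitstrings N" "y \<in> bitstrings N" "x j = y j"
    have "?A x = ?A y" using x(3) by (auto simp: restrict_def fun_eq_iff)
    then show "G x x = G y y" using F x by (simp add: G_def)
  qed
  then obtain c' where c': "\<And>x y. x \<in> bitstrings N \<Longrightarrow> y \<in> bitstrings N \<Longrightarrow> G x y = (if x = y then c' else 0)"
    by blast
  have "braket ds'' (apply_local ds' ds'' {j} M (K \<phi>)) (apply_local ds' ds'' {j} M (K \<psi>))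
      = c' * braket ?Q \<phi> \<psi>" if "\<phi> \<in> vectors ?Q" "\<psi> \<in> vectors ?Q" for \<phi> \<psi>
    using braket_sum_delta[where ds = ?Q and c = c' and \<phi> = \<phi> and \<psi> = \<psi>] by (simp add: br[OF that] c' cong: sum.cong)
  then show ?thesis by blast
qed

text \<open>The invariant of irreducibility: K^dagger K is a scalar. The product form is carried for
  every single-party cut because the next measuring party is arbitrary.\<close>

lemma OPM_reachable_cats:
  assumes "OPM_reachable (replicate N 2) (cats N) ds K" and N: "N \<ge> 2"
  shows "length ds = N \<and> (\<forall>j<N. is_tensor (replicate N 2) ds {j} K) \<and>
    (\<exists>c. \<forall>\<phi>\<in>vectors (replicate N 2). \<forall>\<psi>\<in>vectors (replicate N 2).
      braket ds (K \<phi>) (K \<psi>) = c * braket (replicate N 2) \<phi> \<psi>)"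
  using assms(1)
proof induction
  case start
  show ?case
    by (intro conjI allI impI is_tensor_id exI[of _ 1]) simp_all
next
  case (step ds' K j Ms ds'' M)
  let ?Q = "replicate N (2::nat)"
  let ?K' = "apply_local ds' ds'' {j} M \<circ> K"
  have len': "length ds' = N" and T: "\<And>i. i < N \<Longrightarrow> is_tensor ?Q ds' {i} K" using step.IH by auto
  then have P: "parties ds' = {..<N}" by (simp add: parties_def)
  have j: "j < N" and len'': "length ds'' = N" and d: "\<forall>i\<in>{..<N} - {j}. ds'' ! i = ds' ! i"
    using step.hyps(2,3) len' unfolding local_OPM_def measurement_def P by auto
  have orth: "braket ds'' (apply_local ds' ds'' {j} M \<phi>) (apply_local ds' ds'' {j} M \<psi>) = 0"
    if "\<phi> \<in> K ` cats N" "\<psi> \<in> K ` cats N" "\<phi> \<noteq> \<psi>" for \<phi> \<psi>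
    using step.hyps(2,3) that unfolding local_OPM_def by blast
  have T': "is_tensor ?Q ds'' {i} ?K'" if "i < N" for i
    using T[OF that] that len' len'' d j by (intro is_tensor_apply_local) auto
  obtain c where c: "\<And>\<phi> \<psi>. \<phi> \<in> vectors ?Q \<Longrightarrow> \<psi> \<in> vectors ?Q \<Longrightarrow>
      braket ds' (K \<phi>) (K \<psi>) = c * braket ?Q \<phi> \<psi>" using step.IH by blast
  have norm: "of_real (norm_sq ds' (K \<phi>)) = c * of_real (norm_sq ?Q \<phi>)" if "\<phi> \<in> vectors ?Q" for \<phi>
    using c[OF that that] by (simp add: norm_sq_braket)
  have Kv: "K \<phi> \<in> vectors ds'" if "\<phi> \<in> vectors ?Q" for \<phi>
    using T[OF j] that tensor_op_vectors unfolding is_tensor_def by metis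
  have "\<exists>c'. \<forall>\<phi>\<in>vectors ?Q. \<forall>\<psi>\<in>vectors ?Q. braket ds'' (?K' \<phi>) (?K' \<psi>) = c' * braket ?Q \<phi> \<psi>"
  proof (cases "c = 0")
    \<comment> \<open>A branch of weight zero annihilates every vector, and so does each
      continuation.\<close>
    case True
    have "K \<phi> = zero_vector" if "\<phi> \<in> vectors ?Q" for \<phi>
      using norm[OF that] norm_sq_eq_0_iff[OF Kv[OF that]] True by simp
    then have "?K' \<phi> = zero_vector" if "\<phi> \<in> vectors ?Q" for \<phi>
      using that by (simp add: apply_local_zero)
    then have "braket ds'' (?K' \<phi>) (?K' \<psi>) = 0 * braket ?Q \<phi> \<psi>" if "\<phi> \<in> vectors ?Q" for \<phi> \<psi>
      using that by (simp only:) (simp add: braket_def zero_vector_def)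
    then show ?thesis by blast
  next
    case False
    \<comment> \<open>Orthogonality is demanded only of different elements of the image set, so
      distinct cat states must have distinct images. Equal images would be orthogonal, contradicting
      \<open>c \<noteq> 0\<close>.\<close>
    have inj: "K \<phi> \<noteq> K \<psi>" if "\<phi> \<in> cats N" "\<psi> \<in> cats N" "\<phi> \<noteq> \<psi>" for \<phi> \<psi>
    proof
      assume eq: "K \<phi> = K \<psi>"
      have v: "\<phi> \<in> vectors ?Q" "\<psi> \<in> vectors ?Q" and nz: "\<phi> \<noteq> zero_vector"
        using that cats_vectors cat_neq_zero by (auto simp: cats_def)
      have "braket ?Q \<phi> \<psi> = 0" using mutually_orthogonal_cats[of N] N that
        unfolding mutually_orthogonal_states_def by auto
      then have "of_real (norm_sq ds' (K \<phi>)) = (0::complex)"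
        using c[OF v] eq by (simp add: norm_sq_braket)
      then show False using norm[OF v(1)] False norm_sq_eq_0_iff[OF v(1)] nz by simp
    qed
    show ?thesis unfolding comp_apply
      by (rule OPM_step_scalar[OF N j len' len'' d T[OF j] c False]) (use orth inj in auto)
  qed
  then show ?case using len'' T' by blast
qed

lemma cats_locally_irreducible:
  assumes N: "N \<ge> 2"
  shows "locally_irreducible (replicate N 2) (cats N)"
proof -
  let ?Q = "replicate N (2::nat)"
  have "K \<psi> = zero_vector" if K: "OPM_reachable ?Q (cats N) ds K"
    and \<phi>: "\<phi> \<in> cats N" "K \<phi> = zero_vector" and \<psi>: "\<psi> \<in> cats N" for ds K \<phi> \<psi>
  proof -
    note R = OPM_reachable_cats[OF K N]
    then obtain c where c: "\<And>\<phi> \<psi>. \<phi> \<in> vectors ?Q \<Longrightarrow> \<psi> \<in> vectors ?Q \<Longrightarrow>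
      braket ds (K \<phi>) (K \<psi>) = c * braket ?Q \<phi> \<psi>" by blast
    have v: "\<phi> \<in> vectors ?Q" "\<psi> \<in> vectors ?Q" and nz: "\<phi> \<noteq> zero_vector"
      using \<phi>(1) \<psi> cats_vectors cat_neq_zero by (auto simp: cats_def)
    have "braket ds (K \<phi>) (K \<phi>) = 0" unfolding \<phi>(2) by (simp add: braket_def zero_vector_def)
    then have "c * of_real (norm_sq ?Q \<phi>) = 0" using c[OF v(1) v(1)] by (simp add: norm_sq_braket)
    \<comment> \<open>One annihilated cat state makes the common scalar 0, which annihilates all the
      others.\<close>
    then have "c = 0" using norm_sq_eq_0_iff[OF v(1)] nz by simp
    then have "norm_sq ds (K \<psi>) = 0" using c[OF v(2) v(2)] norm_sq_braket[of ds "K \<psi>"] by simp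
    moreover have "is_tensor ?Q ds {0} K" using R N by auto
    then have "K \<psi> \<in> vectors ds" using v(2) tensor_op_vectors unfolding is_tensor_def by metis
    ultimately show ?thesis using norm_sq_eq_0_iff by blast
  qed
  then show ?thesis using mutually_orthogonal_cats[of N] N unfolding locally_irreducible_def by auto
qed

subsection \<open>The measurement of the first party\<close>

definition bits :: "nat \<Rightarrow> nat \<Rightarrow> nat \<Rightarrow> config" where
  "bits N a k = (\<lambda>i\<in>{..<N}. if i = 0 then a else k div 2 ^ (N - 1 - i) mod 2)"

lemma ket_eq: "ket N a k x = (if x = bits N a k then 1 else 0)"
  by (simp add: ket_def bits_def)

lemma parties_dims: "N > 0 \<Longrightarrow> parties (dims N) = {..<N}"
  by (simp add: parties_def dims_def)

lemma dims_nth: "i < N \<Longrightarrow> dims N ! i = (if i = 0 then 4 else 2)"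
  by (cases i) (auto simp: dims_def)

lemma bits_0: "N > 0 \<Longrightarrow> bits N a k 0 = a"
  by (simp add: bits_def)

lemma bits_configs: "a < 4 \<Longrightarrow> bits N a k \<in> configs (dims N) {..<N}"
  by (auto simp: configs_def bits_def dims_nth)

lemma bits_bitstrings: "a < 2 \<Longrightarrow> bits N a k \<in> bitstrings N"
  by (auto simp: configs_def bits_def)

lemma le_\<alpha>_iff: "k \<le> \<alpha> N \<longleftrightarrow> k < 2 ^ (N - 1)"
proof -
  have "(0::nat) < 2 ^ (N - 1)" by simp
  then show ?thesis unfolding \<alpha>_def by linarith
qed

lemma bits_eq_iff:
  assumes N: "N > 0" and k: "k \<le> \<alpha> N" and l: "l \<le> \<alpha> N"
  shows "bits N a k = bits N b l \<longleftrightarrow> a = b \<and> k = l"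
proof
  assume eq: "bits N a k = bits N b l"
  have "bit k n = bit l n" for n
  proof (cases "n < N - 1")
    case True
    \<comment> \<open>Binary digit \<open>n\<close> is held by party \<open>N - 1 - n\<close>, which
      is not the first one.\<close>
    then have i: "N - 1 - n < N" "N - 1 - n \<noteq> 0" "N - 1 - (N - 1 - n) = n" by auto
    have "bits N c m (N - 1 - n) = m div 2 ^ n mod 2" for c m
      unfolding bits_def restrict_def i(3) using i(1,2) by (simp only: lessThan_iff if_True if_False)
    with eq have "k div 2 ^ n mod 2 = l div 2 ^ n mod 2" by metis
    then show ?thesis by (simp add: bit_iff_odd odd_iff_mod_2_eq_one)
  next
    case False
    then have "k < 2 ^ n" "l < 2 ^ n"
      using k l unfolding le_\<alpha>_iff
      by (auto intro: less_le_trans power_increasing)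
    then show ?thesis by (simp add: bit_iff_odd)
  qed
  then have "k = l" by (simp add: bit_eq_iff)
  moreover have "a = b" using fun_cong[OF eq, of 0] bits_0[OF N] by simp
  ultimately show "a = b \<and> k = l" by simp
qed simp

text \<open>Subtraction from the all-ones number never borrows. With quotients \<open>q\<close> of
  \<open>k\<close> and \<open>p\<close> of its complement by \<open>2 ^ m\<close>,
  \<open>q + 1 + p = 2 ^ (n - m)\<close> is even, so \<open>p\<close> and \<open>q\<close> have
  opposite parity.\<close>

lemma complement_div_mod:
  fixes k m n :: nat
  assumes k: "k < 2 ^ n" and m: "m < n"
  shows "(2 ^ n - 1 - k) div 2 ^ m mod 2 = 1 - k div 2 ^ m mod 2"
proof -
  define q r where "q = k div 2 ^ m" "r = k mod 2 ^ m"
  have kq: "k = q * 2 ^ m + r" and r: "r < 2 ^ m"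
    unfolding q_r_def by (simp_all only: div_mult_mod_eq) simp
  have n: "(2::nat) ^ n = 2 ^ (n - m) * 2 ^ m" using m by (simp flip: power_add)
  have "q * 2 ^ m < 2 ^ (n - m) * 2 ^ m" using k kq n by (metis le_add1 le_less_trans)
  then have q: "q < 2 ^ (n - m)" by simp
  then obtain p where p: "(2::nat) ^ (n - m) = q + 1 + p"
    by (metis add.commute less_iff_Suc_add plus_1_eq_Suc add_Suc_right Suc_eq_plus1)
  have "2 ^ n - 1 - k = p * 2 ^ m + (2 ^ m - 1 - r)"
    using r unfolding n p kq by (simp add: algebra_simps)
  moreover have "(p * 2 ^ m + (2 ^ m - 1 - r)) div 2 ^ m = p"
    by (simp add: div_eq_0_iff)
  ultimately have "(2 ^ n - 1 - k) div 2 ^ m = p" by simp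
  moreover have "even (q + 1 + p)" using p m by (metis even_power even_numeral zero_less_diff)
  then have "p mod 2 = 1 - q mod 2" by presburger
  ultimately show ?thesis unfolding q_r_def[symmetric] by simp
qed

lemma flip_bits:
  assumes "k \<le> \<alpha> N"
  shows "flip N (bits N a k) = bits N (1 - a) (\<alpha> N - k)"
proof
  fix i
  show "flip N (bits N a k) i = bits N (1 - a) (\<alpha> N - k) i"
  proof (cases "i < N \<and> i \<noteq> 0")
    case True
    then have "N - 1 - i < N - 1" by auto
    then show ?thesis
      using complement_div_mod[OF assms[unfolded le_\<alpha>_iff]] True
      by (simp add: flip_def bits_def \<alpha>_def)
  qed (auto simp: flip_def bits_def)
qed

text \<open>Surjectivity by counting: the labelling is injective on a set with as many elements as
  there are bit strings.\<close>

lemma bitstrings_bits: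
  assumes N: "N > 0" and x: "x \<in> bitstrings N"
  shows "\<exists>k\<le>\<alpha> N. x = bits N (x 0) k"
proof -
  let ?f = "\<lambda>(a, k). bits N a k"
  let ?X = "{..<2} \<times> {..\<alpha> N}"
  have inj: "inj_on ?f ?X" by (auto simp: inj_on_def bits_eq_iff[OF N])
  have "card {..\<alpha> N} = 2 ^ (N - 1)" by (simp add: \<alpha>_def)
  then have "card (?f ` ?X) = 2 ^ N"
    using N by (simp add: card_image[OF inj] card_cartesian_product flip: power_Suc)
  moreover have "card (bitstrings N) = 2 ^ N"
    by (simp add: configs_def card_PiE)
  moreover have "?f ` ?X \<subseteq> bitstrings N" using bits_bitstrings by auto
  ultimately have "?f ` ?X = bitstrings N" by (intro card_subset_eq) auto
  then have "x \<in> ?f ` ?X" using x by simp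
  then obtain a k where "k \<le> \<alpha> N" "x = bits N a k" by auto
  then show ?thesis using bits_0[OF N] by auto
qed

lemma cats_eq:
  assumes N: "N > 0"
  shows "cats N = {cat N s (bits N 0 k) | s k. s \<in> {1, -1} \<and> k \<le> \<alpha> N}"
proof (intro equalityI subsetI)
  fix \<psi> assume "\<psi> \<in> cats N"
  then obtain s x where "\<psi> = cat N s x" "s \<in> {1, -1}" "x \<in> bitstrings N" "x 0 = 0"
    by (auto simp: cats_def)
  then show "\<psi> \<in> {cat N s (bits N 0 k) | s k. s \<in> {1, -1} \<and> k \<le> \<alpha> N}"
    using bitstrings_bits[OF N, of x] by auto
next
  fix \<psi> assume "\<psi> \<in> {cat N s (bits N 0 k) | s k. s \<in> {1, -1} \<and> k \<le> \<alpha> N}"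
  then obtain s k where "\<psi> = cat N s (bits N 0 k)" "s \<in> {1, -1}" by auto
  then show "\<psi> \<in> cats N" using bits_bitstrings[of 0 N k] bits_0[OF N, of 0 k]
    unfolding cats_def by auto
qed

lemma \<eta>_apply: "\<eta> N s k x = (if x = bits N 0 k then 1 else 0) +
    s * (if x = bits N 1 (\<alpha> N - k) then 1 else 0) + s * (if x = bits N 2 k then 1 else 0)
    - s * s * (if x = bits N 3 (\<alpha> N - k) then 1 else 0)"
  by (simp add: \<eta>_def ket_eq algebra_simps)

lemma \<eta>_vectors: "N > 0 \<Longrightarrow> \<eta> N s k \<in> vectors (dims N)"
  using bits_configs[of _ N] by (auto simp: vectors_def \<eta>_apply parties_dims)

lemma \<eta>_bits:
  assumes "N > 0" "k \<le> \<alpha> N" "l \<le> \<alpha> N"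
  shows "\<eta> N s k (bits N 0 l) = (if k = l then 1 else 0)"
    "\<eta> N s k (bits N 1 (\<alpha> N - l)) = (if k = l then s else 0)"
    "\<eta> N s k (bits N 2 l) = (if k = l then s else 0)"
    "\<eta> N s k (bits N 3 (\<alpha> N - l)) = (if k = l then - s * s else 0)"
  using assms by (auto simp: \<eta>_apply bits_eq_iff)

text \<open>Different labels give disjoint supports. For equal labels and opposite signs the four
  contributions are 1, -1, -1, 1.\<close>

lemma braket_\<eta>:
  assumes N: "N > 0" and k: "k \<le> \<alpha> N" and l: "l \<le> \<alpha> N" and s: "s \<in> {1, -1}" and t: "t \<in> {1, -1}"
    and ne: "(s, k) \<noteq> (t, l)"
  shows "braket (dims N) (\<eta> N s k) (\<eta> N t l) = 0"
proof -
  have *: "(\<Sum>x\<in>configs (dims N) {..<N}. h x * (if x = bits N a m then 1 else 0)) = h (bits N a m)"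
    if "a < 4" for h :: "config \<Rightarrow> complex" and a m
    using bits_configs[OF that] by (simp add: if_distrib[where f = "\<lambda>c. _ * c"] cong: if_cong)
  have lt: "(0::nat) < 4" "(1::nat) < 4" "(2::nat) < 4" "(3::nat) < 4" by simp_all
  let ?h = "\<lambda>x. cnj (\<eta> N s k x)"
  have "braket (dims N) (\<eta> N s k) (\<eta> N t l) = (\<Sum>x\<in>configs (dims N) {..<N}.
      ?h x * (if x = bits N 0 l then 1 else 0) +
      t * (?h x * (if x = bits N 1 (\<alpha> N - l) then 1 else 0)) +
      t * (?h x * (if x = bits N 2 l then 1 else 0)) -
      t * t * (?h x * (if x = bits N 3 (\<alpha> N - l) then 1 else 0)))"
    unfolding braket_def parties_dims[OF N]
    by (intro sum.cong refl) (simp add: \<eta>_apply[of N t l] algebra_simps)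
  also have "\<dots> = ?h (bits N 0 l) + t * ?h (bits N 1 (\<alpha> N - l)) + t * ?h (bits N 2 l)
      - t * t * ?h (bits N 3 (\<alpha> N - l))"
    by (simp only: sum.distrib sum_subtractf sum_distrib_left[symmetric] *[OF lt(1)] *[OF lt(2)]
        *[OF lt(3)] *[OF lt(4)])
  also have "\<dots> = 0" unfolding \<eta>_bits[OF N k l] using s t ne by (auto split: if_splits)
  finally show ?thesis .
qed

lemma mutually_orthogonal_S5:
  assumes N: "N > 0"
  shows "mutually_orthogonal_states (dims N) (S5 N)"
proof -
  have "\<eta> N s k \<noteq> zero_vector" if "k \<le> \<alpha> N" for s k
    using \<eta>_bits(1)[OF N that that, of s] by (auto simp: zero_vector_def)
  then show ?thesis unfolding mutually_orthogonal_states_def S5_def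
    using \<eta>_vectors[OF N] by (auto intro!: braket_\<eta>[OF N])
qed

text \<open>The truncation to labels 0 and 1 comes from the output dimension 2 in
  \<open>S5_measurement\<close>; the formula itself is that of the identity.\<close>

definition keep01 :: operator where
  "keep01 u v = (if v 0 = u 0 then 1 else 0)"

text \<open>The sign cancels the minus in front of the \<open>3\<close> term. Sending
  \<open>2\<close> to \<open>1\<close> puts the coefficient \<open>s\<close> on the string with
  leading bit 1, as in a cat state.\<close>

definition swap23 :: operator where
  "swap23 u v = (if u 0 = 1 \<and> v 0 = 2 then 1 else if u 0 = 0 \<and> v 0 = 3 then -1 else 0)"

abbreviation S5_measurement :: "nat \<Rightarrow> (nat list \<times> operator) list" where
  "S5_measurement N \<equiv> [(replicate N 2, keep01), (replicate N 2, swap23)]"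

lemma sum_lessThan_4: "(\<Sum>a<(4::nat). f a) = f 0 + f 1 + f 2 + (f 3 :: complex)"
  by (simp add: numeral_eq_Suc lessThan_Suc add_ac)

lemma sum_lessThan_2: "(\<Sum>a<(2::nat). f a) = f 0 + (f 1 :: complex)"
  by (simp add: numeral_eq_Suc lessThan_Suc add_ac)

lemma measurement_S5_measurement:
  assumes N: "N > 0"
  shows "measurement (dims N) {0} (S5_measurement N)"
proof -
  have "(\<Sum>(ds', M)\<leftarrow>S5_measurement N. \<Sum>x\<in>configs ds' {0}. cnj (M x y) * M x y') = (if y = y' then 1 else 0)"
    if y: "y \<in> configs (dims N) {0}" and y': "y' \<in> configs (dims N) {0}" for y y'
  proof -
    \<comment> \<open>Reduces completeness to a check over the sixteen pairs of labels of the first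
      party.\<close>
    have "y = y' \<longleftrightarrow> y 0 = y' 0"
    proof
      assume "y 0 = y' 0"
      then have "restrict y {0} = restrict y' {0}" by (auto simp: restrict_def)
      then show "y = y'" using configs_eqI[OF y y', of "{0}"] by (simp add: restrict_def)
    qed simp
    moreover have "z 0 \<in> {0, 1, 2, 3}" if "z \<in> configs (dims N) {0}" for z
    proof -
      have "z 0 < 4" using that by (simp add: configs_def PiE_iff dims_def)
      then show ?thesis by auto
    qed
    note this[OF y] this[OF y']
    moreover have "(\<Sum>(ds', M)\<leftarrow>S5_measurement N. \<Sum>x\<in>configs ds' {0}. cnj (M x y) * M x y') =
      (\<Sum>a<2. cnj (keep01 (\<lambda>i\<in>{0}. a) y) * keep01 (\<lambda>i\<in>{0}. a) y') +
      (\<Sum>a<2. cnj (swap23 (\<lambda>i\<in>{0}. a) y) * swap23 (\<lambda>i\<in>{0}. a) y')"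
      using N by (simp add: sum_configs_singleton)
    ultimately show ?thesis
      by (elim insertE emptyE) (simp_all add: sum_lessThan_2 keep01_def swap23_def)
  qed
  moreover have "dims N ! i = 2" if "i < N" "i \<noteq> 0" for i using dims_nth[OF that(1)] that(2) by simp
  moreover have "length (dims N) = N" using N by (simp add: dims_def)
  ultimately show ?thesis unfolding measurement_def parties_dims[OF N] by auto
qed

lemma override_bits:
  assumes "N > 0" "x 0 = c"
  shows "override_on x (\<lambda>i\<in>{0}. a) {0} = bits N b k \<longleftrightarrow> a = b \<and> x = bits N c k"
  using assms by (auto simp: fun_eq_iff override_on_def bits_def)

lemma S5_outcomes:
  assumes N: "N > 0" and k: "k \<le> \<alpha> N" and s: "s \<in> {1, -1}"
  shows "apply_local (dims N) (replicate N 2) {0} keep01 (\<eta> N s k) = cat N s (bits N 0 k)"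
    and "apply_local (dims N) (replicate N 2) {0} swap23 (\<eta> N s k) = cat N s (bits N 0 (\<alpha> N - k))"
proof -
  let ?o = "\<lambda>x a. override_on x (\<lambda>i\<in>{0}. a) {0}"
  have ap: "apply_local (dims N) (replicate N 2) {0} M (\<eta> N s k) x =
      (\<Sum>a<4. M (restrict x {0}) (\<lambda>i\<in>{0}. a) * \<eta> N s k (?o x a))"
    if "x \<in> bitstrings N" for M x
    using that N by (simp add: apply_local_def sum_configs_singleton dims_nth)
  have f: "flip N (bits N 0 k) = bits N 1 (\<alpha> N - k)"
    "flip N (bits N 0 (\<alpha> N - k)) = bits N 1 k"
    using flip_bits[OF k, of 0] flip_bits[of "\<alpha> N - k" N 0] k by auto
  have ss: "s * s = 1" using s by auto
  have x0: "x 0 = 0 \<or> x 0 = 1" if "x \<in> bitstrings N" for x using that N by (auto simp: bitstrings_iff)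
  have b: "x \<noteq> bits N a m" if "x 0 \<noteq> a" for x a m using that bits_0[OF N] by auto
  have off: "cat N s (bits N 0 m) x = 0" if "x \<notin> bitstrings N" "m \<le> \<alpha> N" for x m
    using cat_vectors[OF bits_bitstrings[of 0 N m], of s] that by (simp add: vectors_def)
  show "apply_local (dims N) (replicate N 2) {0} keep01 (\<eta> N s k) = cat N s (bits N 0 k)"
  proof
    fix x
    show "apply_local (dims N) (replicate N 2) {0} keep01 (\<eta> N s k) x = cat N s (bits N 0 k) x"
    proof (cases "x \<in> bitstrings N")
      case x: True
      from x0[OF x] show ?thesis
      proof
        assume "x 0 = 0"
        then show ?thesis using b[of x 1] ss
          by (simp add: ap[OF x] sum_lessThan_4 keep01_def cat_def f \<eta>_apply override_bits[OF N])
      next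
        assume "x 0 = 1"
        then show ?thesis using b[of x 0] ss
          by (simp add: ap[OF x] sum_lessThan_4 keep01_def cat_def f \<eta>_apply override_bits[OF N])
      qed
    qed (simp add: apply_local_def off k)
  qed
  show "apply_local (dims N) (replicate N 2) {0} swap23 (\<eta> N s k) = cat N s (bits N 0 (\<alpha> N - k))"
  proof
    fix x
    show "apply_local (dims N) (replicate N 2) {0} swap23 (\<eta> N s k) x
        = cat N s (bits N 0 (\<alpha> N - k)) x"
    proof (cases "x \<in> bitstrings N")
      case x: True
      \<comment> \<open>Row 0 reads the coefficient at label 3 with sign -1, and row 1 the one at
        label 2.\<close>
      from x0[OF x] show ?thesis
      proof
        assume "x 0 = 0"
        then show ?thesis using b[of x 1] ss
          by (simp add: ap[OF x] sum_lessThan_4 swap23_def cat_def f \<eta>_apply override_bits[OF N])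
      next
        assume "x 0 = 1"
        then show ?thesis using b[of x 0] ss
          by (simp add: ap[OF x] sum_lessThan_4 swap23_def cat_def f \<eta>_apply override_bits[OF N])
      qed
    qed (simp add: apply_local_def off)
  qed
qed

lemma image_S5:
  assumes "\<And>s k. s \<in> {1, -1} \<Longrightarrow> k \<le> \<alpha> N \<Longrightarrow> F (\<eta> N s k) = G s k"
  shows "F ` S5 N = {G s k | s k. s \<in> {1, -1} \<and> k \<le> \<alpha> N}"
proof (intro equalityI subsetI)
  fix \<psi> assume "\<psi> \<in> F ` S5 N"
  then obtain s k where "\<psi> = F (\<eta> N s k)" "s \<in> {1, -1}" "k \<le> \<alpha> N" unfolding S5_def by blast
  then show "\<psi> \<in> {G s k | s k. s \<in> {1, -1} \<and> k \<le> \<alpha> N}" using assms by blast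
next
  fix \<psi> assume "\<psi> \<in> {G s k | s k. s \<in> {1, -1} \<and> k \<le> \<alpha> N}"
  then obtain s k where "\<psi> = F (\<eta> N s k)" "s \<in> {1, -1}" "k \<le> \<alpha> N" using assms by force
  then show "\<psi> \<in> F ` S5 N" unfolding S5_def by blast
qed

text \<open>The second outcome relabels \<open>k\<close> as \<open>\<alpha> N - k\<close>, an
  involution on the labels, so it too reaches the whole basis.\<close>

lemma S5_image:
  assumes N: "N > 0" and M: "(ds', M) \<in> set (S5_measurement N)"
  shows "apply_local (dims N) ds' {0} M ` S5 N = cats N"
proof -
  have "cats N \<subseteq> {cat N s (bits N 0 (\<alpha> N - k)) | s k. s \<in> {1, -1} \<and> k \<le> \<alpha> N}"
  proof
    fix \<psi> assume "\<psi> \<in> cats N"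
    then obtain s k where sk: "\<psi> = cat N s (bits N 0 k)" "s \<in> {1, -1}" "k \<le> \<alpha> N"
      unfolding cats_eq[OF N] by blast
    then have "\<psi> = cat N s (bits N 0 (\<alpha> N - (\<alpha> N - k)))" by simp
    then show "\<psi> \<in> {cat N s (bits N 0 (\<alpha> N - k)) | s k. s \<in> {1, -1} \<and> k \<le> \<alpha> N}"
      using sk(2) diff_le_self by blast
  qed
  moreover have "{cat N s (bits N 0 (\<alpha> N - k)) | s k. s \<in> {1, -1} \<and> k \<le> \<alpha> N} \<subseteq> cats N"
    unfolding cats_eq[OF N] using diff_le_self by blast
  ultimately have "{cat N s (bits N 0 (\<alpha> N - k)) | s k. s \<in> {1, -1} \<and> k \<le> \<alpha> N} = cats N"
    by blast
  moreover have "apply_local (dims N) (replicate N 2) {0} swap23 ` S5 N =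
      {cat N s (bits N 0 (\<alpha> N - k)) | s k. s \<in> {1, -1} \<and> k \<le> \<alpha> N}"
    by (intro image_S5 S5_outcomes(2)[OF N])
  moreover have "apply_local (dims N) (replicate N 2) {0} keep01 ` S5 N = cats N"
    unfolding cats_eq[OF N] by (intro image_S5 S5_outcomes(1)[OF N])
  ultimately show ?thesis using M by auto
qed

lemma local_OPM_S5_measurement:
  assumes N: "N > 0"
  shows "local_OPM (dims N) (S5 N) 0 (S5_measurement N)"
proof -
  have orth: "braket ds' (apply_local (dims N) ds' {0} M (\<eta> N s k))
      (apply_local (dims N) ds' {0} M (\<eta> N t l)) = 0"
    if M: "(ds', M) \<in> set (S5_measurement N)" and *: "k \<le> \<alpha> N" "l \<le> \<alpha> N" "s \<in> {1, -1}" "t \<in> {1, -1}"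
      "(s, k) \<noteq> (t, l)" for ds' M s k t l
  proof -
    have c: "braket (replicate N 2) (cat N s (bits N 0 k')) (cat N t (bits N 0 l')) = 0"
      if "k' \<le> \<alpha> N" "l' \<le> \<alpha> N" "(s, k') \<noteq> (t, l')" for k' l'
      using that * by (intro braket_cat_cat bits_bitstrings N bits_0) (auto simp: bits_eq_iff[OF N])
    \<comment> \<open>Truncated subtraction is injective here because both labels are at most
      \<open>\<alpha> N\<close>.\<close>
    have "(s, \<alpha> N - k) \<noteq> (t, \<alpha> N - l)" using * by auto
    then show ?thesis using M * c
      by (auto simp: S5_outcomes[OF N])
  qed
  have "braket ds' (apply_local (dims N) ds' {0} M \<phi>) (apply_local (dims N) ds' {0} M \<psi>) = 0"
    if M: "(ds', M) \<in> set (S5_measurement N)" and S5: "\<phi> \<in> S5 N" "\<psi> \<in> S5 N" and ne: "\<phi> \<noteq> \<psi>" for ds' M \<phi> \<psi>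
  proof -
    obtain s k t l where "\<phi> = \<eta> N s k" "s \<in> {1, -1}" "k \<le> \<alpha> N" "\<psi> = \<eta> N t l" "t \<in> {1, -1}" "l \<le> \<alpha> N"
      using S5 unfolding S5_def by blast
    moreover from this ne have "(s, k) \<noteq> (t, l)" by blast
    ultimately show ?thesis using orth[OF M, of k l s t] by blast
  qed
  then show ?thesis unfolding local_OPM_def
    using measurement_S5_measurement[OF N] parties_dims[OF N] N by blast
qed

theorem theorem5:
  fixes N :: nat
  assumes "N \<ge> 2"
  shows "mutually_orthogonal_states (dims N) (S5 N) \<and>
    deterministically_convertible (dims N) (S5 N) (\<lambda>ds T.
      locally_irreducible ds T \<and>
      (\<forall>\<psi>\<in>T. genuinely_entangled ds \<psi>) \<and>
      (\<forall>j<N. LOCC_indistinguishable {{j}, {..<N} - {j}} ds T))"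
proof -
  have N: "N > 0" using assms by simp
  have nz: "cats N - {zero_vector} = cats N" using cat_neq_zero by (auto simp: cats_def)
  have "\<forall>\<psi>\<in>cats N. genuinely_entangled (replicate N 2) \<psi>"
    using cat_genuinely_entangled[OF _ N] by (auto simp: cats_def)
  moreover have "LOCC_indistinguishable {{j}, {..<N} - {j}} (replicate N 2) (cats N)" if "j < N" for j
  proof (rule cats_LOCC_indistinguishable)
    \<comment> \<open>With at least two parties, a single one is a proper part of the whole.\<close>
    have "card {j} \<noteq> card {..<N}" using assms by simp
    then have "{j} \<noteq> {..<N}" by metis
    then show "{j} \<subset> {..<N}" using that by (simp add: psubset_eq)
  qed simp
  ultimately have Q: "locally_irreducible (replicate N 2) (cats N) \<and>
      (\<forall>\<psi>\<in>cats N. genuinely_entangled (replicate N 2) \<psi>) \<and>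
      (\<forall>j<N. LOCC_indistinguishable {{j}, {..<N} - {j}} (replicate N 2) (cats N))"
    using cats_locally_irreducible[OF assms] by blast
  have "deterministically_convertible (dims N) (S5 N) (\<lambda>ds T.
      locally_irreducible ds T \<and>
      (\<forall>\<psi>\<in>T. genuinely_entangled ds \<psi>) \<and>
      (\<forall>j<N. LOCC_indistinguishable {{j}, {..<N} - {j}} ds T))"
    unfolding deterministically_convertible_def
  proof (intro exI conjI ballI)
    show "local_OPM (dims N) (S5 N) 0 (S5_measurement N)" by (rule local_OPM_S5_measurement[OF N])
    fix m assume m: "m \<in> set (S5_measurement N)"
    obtain ds' M where dM: "m = (ds', M)" by (cases m)
    with m have "ds' = replicate N 2" by auto
    moreover have "apply_local (dims N) ds' {0} M ` S5 N - {zero_vector} = cats N"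
      using S5_image[OF N, of ds' M] m dM nz by simp
    ultimately show "case m of (ds', M) \<Rightarrow>
        locally_irreducible ds' (apply_local (dims N) ds' {0} M ` S5 N - {zero_vector}) \<and>
        (\<forall>\<psi>\<in>apply_local (dims N) ds' {0} M ` S5 N - {zero_vector}. genuinely_entangled ds' \<psi>) \<and>
        (\<forall>j<N. LOCC_indistinguishable {{j}, {..<N} - {j}} ds'
          (apply_local (dims N) ds' {0} M ` S5 N - {zero_vector}))"
      using Q dM by simp
  qed
  then show ?thesis using mutually_orthogonal_S5[OF N] by blast
qed

end
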